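(* Let $n\ge 2$. For $1\le i\le n$ let $\theta_i=\theta_i^{A_{n-1}}=\sum_{j\neq i}(ij)\in\Lambda_{quad}(A_{n-1})$. Then $$\epsilon_k\bigl(\theta_1^2,\ldots,\theta_n^2\bigr)=0\qquad (1\le k\le n),$$ where $\epsilon_k$ is the $k$-th elementary symmetric polynomial. Moreover, $$\theta_1\theta_2\cdots\theta_n=0,$$ $$\sum_{i=1}^n(-1)^{i+1}\theta_1\cdots\widehat{\theta_i}\cdots\theta_n=0 ,$$ where $\widehat{\theta_i}$ means that the factor $\theta_i$ is omitted.
   Context: $K$ is a field of characteristic zero. $\Lambda_{quad}(A_{n-1})$ is the unital associative $K$-algebra generated by symbols $(ij)=(ji)$, $1\le i\ne j\le n$ (one for each transposition of the symmetric group $S_n$), subject to the relations: $(ij)^2=0$; $(ij)(kl)+(kl)(ij)=0$ if $\{i,j\}\cap\{k,l\}=\emptyset$; $(ij)(jk)+(jk)(ki)+(ki)(ij)=0$ for all distinct $i,j,k$. Juxtaposition $(ij)(kl)$ denotes the product in this algebra, not in the group. The elements $\theta_i$ satisfy $\theta_i\theta_j+\theta_j\theta_i=0$ for $i\neq j$, so that the squares $\theta_i^2$ commute pairwise and $\epsilon_k(\theta_1^2,\ldots,\theta_n^2)=\sum_{i_1<\cdots<i_k}\theta_{i_1}^2\cdots\theta_{i_k}^2$ is well defined. An empty product equals $1$. *)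

theory Defs
  imports "HOL-Algebra.QuotRing" "HOL-Algebra.Module" "HOL-Library.Poly_Mapping"
begin

text \<open>
  Words form the free monoid, written additively: the product of \<^typ>\<open>'w \<Rightarrow>\<^sub>0 'k\<close> is the
  convolution product over a \<^class>\<open>monoid_add\<close> (not necessarily commutative).
\<close>

datatype 'x fmon = Fmon (letters: "'x list")

instantiation fmon :: (type) monoid_add
begin
definition "0 = Fmon []"
definition "u + v = Fmon (letters u @ letters v)"
instance by standard (auto simp: zero_fmon_def plus_fmon_def)
end

text \<open>
  The carrier restricts to words in \<open>X\<close>: the type contains the words in all letters \<open>'x\<close>.
  The scalar \<open>c\<close> is identified with \<open>c\<close> times the empty word.
\<close>

definition free_algebra :: "'x set \<Rightarrow> ('k::field, 'x fmon \<Rightarrow>\<^sub>0 'k) module" where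
  "free_algebra X =
    \<lparr>carrier = {p. \<forall>w \<in> Poly_Mapping.keys p. set (letters w) \<subseteq> X},
     mult = (*), one = 1, zero = 0, add = (+),
     smult = (\<lambda>c p. Poly_Mapping.single 0 c * p)\<rparr>"

definition free_gen :: "'x \<Rightarrow> ('x fmon \<Rightarrow>\<^sub>0 'k::field)" where
  "free_gen x = Poly_Mapping.single (Fmon [x]) 1"

text \<open>
  Quotient of an algebra by a two-sided ideal: the quotient ring of the library together with
  the induced scalar multiplication \<open>c (I + p) = I + c p\<close>. A unital algebra contains its
  scalars as central elements \<open>c 1\<close>, so ring ideals are automatically closed under scalars.
\<close>

definition quot_algebra :: "('k, 'a) module \<Rightarrow> 'a set \<Rightarrow> ('k, 'a set) module" where
  "quot_algebra A I =
    ring.extend (A Quot I)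
      (module.fields (\<lambda>c P. \<Union>p\<in>P. I +>\<^bsub>A\<^esub> (c \<odot>\<^bsub>A\<^esub> p)))"

text \<open>
  The transposition exchanging \<open>i\<close> and \<open>j\<close> is encoded by the two-element set \<open>{i, j}\<close>,
  so that the symbols \<open>(ij)\<close> and \<open>(ji)\<close> coincide.
\<close>

definition transps :: "nat \<Rightarrow> nat set set" where
  "transps n = {{i, j} | i j. i \<in> {1..n} \<and> j \<in> {1..n} \<and> i \<noteq> j}"

definition quad_rels :: "nat \<Rightarrow> (nat set fmon \<Rightarrow>\<^sub>0 'k::field) set" where
  "quad_rels n =
    {free_gen {i, j} * free_gen {i, j} | i j.
       i \<in> {1..n} \<and> j \<in> {1..n} \<and> i \<noteq> j} \<union>
    {free_gen {i, j} * free_gen {k, l} + free_gen {k, l} * free_gen {i, j} | i j k l.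
       i \<in> {1..n} \<and> j \<in> {1..n} \<and> k \<in> {1..n} \<and> l \<in> {1..n} \<and>
       i \<noteq> j \<and> k \<noteq> l \<and> {i, j} \<inter> {k, l} = {}} \<union>
    {free_gen {i, j} * free_gen {j, k} + free_gen {j, k} * free_gen {k, i}
       + free_gen {k, i} * free_gen {i, j} | i j k.
       i \<in> {1..n} \<and> j \<in> {1..n} \<and> k \<in> {1..n} \<and>
       i \<noteq> j \<and> j \<noteq> k \<and> i \<noteq> k}"

definition quad_ideal :: "nat \<Rightarrow> (nat set fmon \<Rightarrow>\<^sub>0 'k::field) set" where
  "quad_ideal n = Idl\<^bsub>free_algebra (transps n)\<^esub> (quad_rels n)"

definition Lambda_quad ::
  "'k itself \<Rightarrow> nat \<Rightarrow> ('k::field, (nat set fmon \<Rightarrow>\<^sub>0 'k) set) module" where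
  "Lambda_quad K n = quot_algebra (free_algebra (transps n)) (quad_ideal n)"

definition transp_gen :: "'k itself \<Rightarrow> nat \<Rightarrow> nat \<Rightarrow> nat \<Rightarrow> (nat set fmon \<Rightarrow>\<^sub>0 'k::field) set" where
  "transp_gen K n i j = quad_ideal n +>\<^bsub>free_algebra (transps n)\<^esub> free_gen {i, j}"

definition theta :: "'k itself \<Rightarrow> nat \<Rightarrow> nat \<Rightarrow> (nat set fmon \<Rightarrow>\<^sub>0 'k::field) set" where
  "theta K n i = (\<Oplus>\<^bsub>Lambda_quad K n\<^esub> j \<in> {1..n} - {i}. transp_gen K n i j)"

definition list_prod :: "('a, 'm) ring_scheme \<Rightarrow> 'a list \<Rightarrow> 'a" where
  "list_prod R xs = foldr (\<lambda>x y. x \<otimes>\<^bsub>R\<^esub> y) xs \<one>\<^bsub>R\<^esub>"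

text \<open>
  The summation index \<open>S = {i\<^sub>1 < \<dots> < i\<^sub>k}\<close> contributes the product of its
  elements in increasing order; for pairwise commuting \<open>x\<close> the order does not matter.
\<close>

definition esym :: "('a, 'm) ring_scheme \<Rightarrow> nat \<Rightarrow> nat \<Rightarrow> (nat \<Rightarrow> 'a) \<Rightarrow> 'a" where
  "esym R n k x =
    (\<Oplus>\<^bsub>R\<^esub> S \<in> {S. S \<subseteq> {1..n} \<and> card S = k}. list_prod R (map x (sorted_list_of_set S)))"

lemma free_algebra_simps [simp]:
  "carrier (free_algebra X) = {p. \<forall>w \<in> Poly_Mapping.keys p. set (letters w) \<subseteq> X}"
  "mult (free_algebra X) = (*)" "one (free_algebra X) = 1"
  "zero (free_algebra X) = 0" "add (free_algebra X) = (+)"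
  "smult (free_algebra X) = (\<lambda>c p. Poly_Mapping.single 0 c * p)"
  by (simp_all add: free_algebra_def)

lemma free_algebra_mult_closed:
  assumes "p \<in> carrier (free_algebra X)" "q \<in> carrier (free_algebra X)"
  shows "p * q \<in> carrier (free_algebra X)"
  using assms keys_mult[of p q] by (fastforce simp: plus_fmon_def)

lemma free_algebra_add_closed:
  assumes "p \<in> carrier (free_algebra X)" "q \<in> carrier (free_algebra X)"
  shows "p + q \<in> carrier (free_algebra X)"
  using assms Poly_Mapping.keys_add[of p q] by auto

lemma free_algebra_ring: "ring (free_algebra X :: ('k::field, 'x fmon \<Rightarrow>\<^sub>0 'k) module)"
  (is "ring ?F")
proof (rule ringI)
  show "abelian_group ?F"
  proof (rule abelian_groupI)
    fix p assume p: "p \<in> carrier ?F"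
    show "\<exists>q\<in>carrier ?F. q \<oplus>\<^bsub>?F\<^esub> p = \<zero>\<^bsub>?F\<^esub>"
      using p by (intro bexI[of _ "- p"]) auto
  next
    fix p q assume "p \<in> carrier ?F" "q \<in> carrier ?F"
    then show "p \<oplus>\<^bsub>?F\<^esub> q \<in> carrier ?F"
      using free_algebra_add_closed[of p X q] by simp
  qed (auto simp: algebra_simps)
  show "Group.monoid ?F"
  proof (rule monoidI)
    show "\<one>\<^bsub>?F\<^esub> \<in> carrier ?F"
      by (auto simp: zero_fmon_def simp flip: single_one)
  next
    fix p q assume "p \<in> carrier ?F" "q \<in> carrier ?F"
    then show "p \<otimes>\<^bsub>?F\<^esub> q \<in> carrier ?F"
      using free_algebra_mult_closed[of p X q] by simp
  qed (auto simp: mult.assoc)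
qed (auto simp: algebra_simps)

lemma free_gen_closed: "x \<in> X \<Longrightarrow> free_gen x \<in> carrier (free_algebra X)"
  by (auto simp: free_gen_def)

lemma transps_memI:
  "i \<in> {1..n} \<Longrightarrow> j \<in> {1..n} \<Longrightarrow> i \<noteq> j \<Longrightarrow> {i, j} \<in> transps n"
  by (auto simp: transps_def)

lemma quad_rels_closed:
  "quad_rels n \<subseteq> carrier (free_algebra (transps n))"
  unfolding quad_rels_def
  by (auto simp del: free_algebra_simps(1)
      intro!: free_algebra_add_closed free_algebra_mult_closed free_gen_closed transps_memI)

lemma quad_ideal_ideal: "ideal (quad_ideal n) (free_algebra (transps n))"
  unfolding quad_ideal_def by (rule ring.genideal_ideal[OF free_algebra_ring quad_rels_closed])

lemma Lambda_quad_simps: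
  "carrier (Lambda_quad K n) = carrier (free_algebra (transps n) Quot quad_ideal n)"
  "mult (Lambda_quad K n) = mult (free_algebra (transps n) Quot quad_ideal n)"
  "one (Lambda_quad K n) = one (free_algebra (transps n) Quot quad_ideal n)"
  "zero (Lambda_quad K n) = zero (free_algebra (transps n) Quot quad_ideal n)"
  "add (Lambda_quad K n) = add (free_algebra (transps n) Quot quad_ideal n)"
  by (simp_all add: Lambda_quad_def quot_algebra_def ring.defs module.defs)

lemma Lambda_quad_ring: "ring (Lambda_quad K n)"
proof -
  interpret Q: ring "free_algebra (transps n) Quot (quad_ideal n :: (nat set fmon \<Rightarrow>\<^sub>0 'a) set)"
    by (rule ideal.quotient_is_ring[OF quad_ideal_ideal])
  show ?thesis
  proof (rule ringI)
    show "abelian_group (Lambda_quad K n)"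
    proof (rule abelian_groupI)
      fix x assume "x \<in> carrier (Lambda_quad K n)"
      then have x: "x \<in> carrier (free_algebra (transps n) Quot (quad_ideal n))"
        by (simp only: Lambda_quad_simps)
      show "\<exists>y\<in>carrier (Lambda_quad K n). y \<oplus>\<^bsub>Lambda_quad K n\<^esub> x = \<zero>\<^bsub>Lambda_quad K n\<^esub>"
        unfolding Lambda_quad_simps using Q.a_inv_closed[OF x] Q.l_neg[OF x] by (rule bexI[rotated])
    next
      fix x y assume "x \<in> carrier (Lambda_quad K n)" "y \<in> carrier (Lambda_quad K n)"
      then show "x \<oplus>\<^bsub>Lambda_quad K n\<^esub> y = y \<oplus>\<^bsub>Lambda_quad K n\<^esub> x"
        unfolding Lambda_quad_simps by (rule Q.a_comm)
    qed (simp_all only: Lambda_quad_simps Q.a_closed Q.zero_closed Q.a_assoc Q.l_zero)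
    show "Group.monoid (Lambda_quad K n)"
      by (rule monoidI) (simp_all only: Lambda_quad_simps Q.m_closed Q.one_closed Q.m_assoc Q.l_one Q.r_one)
  qed (simp_all only: Lambda_quad_simps Q.l_distr Q.r_distr)
qed

lemma Lambda_quad_smult:
  assumes "p \<in> carrier (free_algebra (transps n))"
  shows "c \<odot>\<^bsub>Lambda_quad K n\<^esub> (quad_ideal n +>\<^bsub>free_algebra (transps n)\<^esub> p) =
    quad_ideal n +>\<^bsub>free_algebra (transps n)\<^esub> (c \<odot>\<^bsub>free_algebra (transps n)\<^esub> p)"
proof -
  let ?F = "free_algebra (transps n) :: ('a, nat set fmon \<Rightarrow>\<^sub>0 'a) module"
  let ?I = "quad_ideal n :: (nat set fmon \<Rightarrow>\<^sub>0 'a) set"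
  interpret ideal ?I ?F by (rule quad_ideal_ideal)
  define s :: "nat set fmon \<Rightarrow>\<^sub>0 'a" where "s = Poly_Mapping.single 0 c"
  have s: "s \<in> carrier ?F" by (auto simp: s_def zero_fmon_def)
  have *: "?I +>\<^bsub>?F\<^esub> (s * q) = ?I +>\<^bsub>?F\<^esub> (s * p)" if q: "q \<in> ?I +>\<^bsub>?F\<^esub> p" for q
  proof -
    obtain h where h: "h \<in> ?I" "q = h + p"
      using q unfolding a_r_coset_def' by auto
    have "s * h \<in> ?I" using I_l_closed[OF h(1) s] by simp
    then have "s * q \<in> ?I +>\<^bsub>?F\<^esub> (s * p)"
      using h(2) unfolding a_r_coset_def' by (auto simp: distrib_left)
    moreover have "s * p \<in> carrier ?F" by (rule free_algebra_mult_closed[OF s assms])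
    ultimately show ?thesis using a_repr_independence a_subgroup by metis
  qed
  have "p \<in> ?I +>\<^bsub>?F\<^esub> p" using a_rcos_self assms by blast
  then have "(\<Union>q\<in>?I +>\<^bsub>?F\<^esub> p. ?I +>\<^bsub>?F\<^esub> (s * q)) = ?I +>\<^bsub>?F\<^esub> (s * p)"
    using * by blast
  then show ?thesis
    by (simp add: Lambda_quad_def quot_algebra_def ring.defs module.defs s_def)
qed

end

theory Submission
  imports Defs "HOL-Combinatorics.Permutations" "HOL-Library.Multiset"
begin

text \<open>
  Adjoin parameters \<open>A\<^sub>i\<close> with \<open>A\<^sub>i A\<^sub>j = - A\<^sub>j A\<^sub>i\<close> and \<open>(ij) A\<^sub>k = - A\<^bsub>s(k)\<^esub> (ij)\<close>, where
  \<open>s\<close> exchanges \<open>i\<close> and \<open>j\<close>. Then the elements \<open>x\<^sub>i = A\<^sub>i + \<theta>\<^sub>i\<close> still anticommute, and it turns out that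
  their invariants do not depend on the \<open>\<theta>\<close>-part: \<open>x\<^sub>1 \<cdots> x\<^sub>n = A\<^sub>1 \<cdots> A\<^sub>n\<close>, and the elementary
  symmetric functions of the \<open>x\<^sub>i\<^sup>2\<close> equal those of the \<open>A\<^sub>i\<^sup>2\<close>. Comparing the components of degree
  zero in the parameters gives the first two claims. For the third, each \<open>A\<^sub>i\<close> contains a common summand
  \<open>\<tau>\<close> of square zero, and one compares the components linear in \<open>\<tau>\<close>.

  The difference \<open>G\<close> of the two sides commutes with all \<open>x\<^sub>i\<^sup>2\<close>. As the \<open>A\<^sub>i\<^sup>2\<close> separate permutations,
  the lowest component of \<open>G\<close> involves only words \<open>(i\<^sub>1 j\<^sub>1) (i\<^sub>2 j\<^sub>2) \<cdots>\<close> whose product in the symmetric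
  group is trivial, and those occurring vanish for combinatorial reasons. For the product of the
  \<open>x\<^sub>i\<close> the words have distinct centres \<open>i\<^sub>1, i\<^sub>2, \<dots>\<close>, and some \<open>(ij)\<close> occurs twice. For
  the power sum of the \<open>x\<^sub>i\<^bsup>2k\<^esup>\<close> the words have a single centre. By induction only words involving
  all \<open>m\<close> indices matter, and if \<open>k < m\<close> such a word has two equal neighbours. The power sums with \<open>k \<ge> m\<close>
  follow by Newton's identities from the product formula.
\<close>

section \<open>Words of transpositions\<close>

definition touches :: "'a \<Rightarrow> 'a \<times> 'a \<Rightarrow> bool" where
  "touches x t \<longleftrightarrow> x = fst t \<or> x = snd t"

primrec word_perm :: "('a \<times> 'a) list \<Rightarrow> 'a \<Rightarrow> 'a" where
  "word_perm [] = id"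
| "word_perm (t # ts) = transpose (fst t) (snd t) \<circ> word_perm ts"

lemma word_perm_append: "word_perm (us @ vs) = word_perm us \<circ> word_perm vs"
  by (induction us) (auto simp: o_assoc)

lemma bij_word_perm: "bij (word_perm ts)"
proof (induction ts)
  case (Cons t ts)
  show ?case unfolding word_perm.simps by (rule bij_comp[OF Cons bij_transpose])
qed (auto intro!: bij_betw_byWitness[where f'=id])

lemma inj_word_perm: "inj (word_perm ts)"
  using bij_word_perm bij_is_inj by blast

lemma word_perm_untouched: "\<forall>t\<in>set ts. \<not> touches x t \<Longrightarrow> word_perm ts x = x"
  by (induction ts) (auto simp: touches_def transpose_def)

lemma word_perm_outside: "\<forall>t\<in>set ts. fst t \<in> U \<and> snd t \<in> U \<Longrightarrow> x \<notin> U \<Longrightarrow> word_perm ts x = x"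
  by (rule word_perm_untouched) (auto simp: touches_def)

lemma word_perm_filter_proper:
  "word_perm (filter (\<lambda>t. fst t \<noteq> snd t) ts) = word_perm ts"
  by (induction ts) auto

text \<open>Since \<open>us\<close> and \<open>vs\<close> fix \<open>x\<close>, a trivial product
  would make \<open>us\<close> send both \<open>x\<close> and its partner in \<open>t\<close> to
  \<open>x\<close>, against injectivity.\<close>

lemma word_perm_touched_once:
  assumes "touches x t" "fst t \<noteq> snd t"
    and "\<forall>s\<in>set us. \<not> touches x s" "\<forall>s\<in>set vs. \<not> touches x s"
  shows "word_perm (us @ t # vs) \<noteq> id"
proof
  assume id: "word_perm (us @ t # vs) = id"
  define y where "y = transpose (fst t) (snd t) x"
  have "y \<noteq> x" using assms(1,2) by (auto simp: y_def touches_def transpose_def)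
  have "word_perm us y = word_perm (us @ t # vs) x"
    using word_perm_untouched[OF assms(4)] by (simp add: word_perm_append y_def)
  also have "\<dots> = word_perm us x"
    using id word_perm_untouched[OF assms(3)] by simp
  finally show False using \<open>y \<noteq> x\<close> inj_word_perm[of us] by (auto dest: injD)
qed

lemma touched_twice:
  assumes "word_perm ts = id" "t \<in> set ts" "touches x t" "\<forall>s\<in>set ts. fst s \<noteq> snd s"
    and "distinct ts"
  obtains s where "s \<in> set ts" "s \<noteq> t" "touches x s"
proof -
  obtain us vs where ts: "ts = us @ t # vs" using split_list[OF assms(2)] by blast
  then have "\<not> ((\<forall>s\<in>set us. \<not> touches x s) \<and> (\<forall>s\<in>set vs. \<not> touches x s))"
    using assms(1-4) word_perm_touched_once[of x t us vs] by blast
  then obtain s where "s \<in> set us \<union> set vs" "touches x s" by blast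
  moreover have "s \<noteq> t" using \<open>s \<in> _\<close> ts assms(5) by auto
  ultimately show ?thesis using that[of s] ts by auto
qed

text \<open>The rightmost letter acts first and moves the centre to \<open>last bs\<close>; the
  remaining letters do not touch that point.\<close>

lemma star_word_perm_distinct:
  assumes "distinct bs" "i \<notin> set bs" "bs \<noteq> []"
  shows "word_perm (map (Pair i) bs) i = last bs"
proof -
  obtain cs b where bs: "bs = cs @ [b]" using assms(3) by (cases bs rule: rev_cases) auto
  have "word_perm (map (Pair i) cs) b = b"
    using assms bs by (intro word_perm_untouched) (auto simp: touches_def)
  then show ?thesis by (simp add: bs word_perm_append)
qed

text \<open>Take a repetition with the shortest gap \<open>bs\<close>: a repetition inside the gap,
  or another \<open>a\<close> there, would give a shorter one.\<close>

lemma repeated_split_minimal: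
  assumes "\<not> distinct as"
  obtains us a bs vs where "as = us @ a # bs @ a # vs" "distinct bs" "a \<notin> set bs"
proof -
  let ?P = "\<lambda>k. \<exists>us a bs vs. as = us @ a # bs @ a # vs \<and> length bs = k"
  have "\<exists>k. ?P k" using not_distinct_decomp[OF assms] by fastforce
  then have P: "?P (LEAST k. ?P k)" by (rule LeastI_ex)
  then obtain us a bs vs where *: "as = us @ a # bs @ a # vs" "length bs = (LEAST k. ?P k)"
    by blast
  have least: "length bs \<le> k" if "?P k" for k using that *(2) by (metis (mono_tags, lifting) Least_le)
  have "distinct bs"
  proof (rule ccontr)
    assume "\<not> distinct bs"
    then obtain xs y ys zs where "bs = xs @ [y] @ ys @ [y] @ zs" using not_distinct_decomp by blast
    then have "as = (us @ a # xs) @ y # ys @ y # (zs @ a # vs)" using * by simp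
    then have "length bs \<le> length ys" by (intro least) blast
    with \<open>bs = _\<close> show False by simp
  qed
  moreover have "a \<notin> set bs"
  proof
    assume "a \<in> set bs"
    then obtain xs ys where "bs = xs @ a # ys" by (meson split_list)
    then have "as = us @ a # xs @ a # (ys @ a # vs)" using * by simp
    then have "length bs \<le> length xs" by (intro least) blast
    with \<open>bs = _\<close> show False by simp
  qed
  ultimately show ?thesis using that * by blast
qed

text \<open>
  The first letter that is repeated encloses a product moving the centre \<open>i\<close>, so it cannot
  occur just twice in a trivial product.
\<close>
lemma star_word_adjacent:
  assumes i: "i \<notin> set as" and id: "word_perm (map (Pair i) as) = id"
    and len: "length as \<le> 2 * card (set as)" and ne: "as \<noteq> []"
  obtains us a vs where "as = us @ a # a # vs"
proof -
  \<comment> \<open>A partner occurring once would be touched by a single letter and hence be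
    moved.\<close>
  have ge2: "count_list as a \<ge> 2" if a: "a \<in> set as" for a
  proof (rule ccontr)
    assume "\<not> count_list as a \<ge> 2"
    moreover obtain us vs where as: "as = us @ a # vs" using split_list[OF a] by blast
    ultimately have "count_list us a = 0" "count_list vs a = 0" by simp_all
    then have "a \<notin> set us" "a \<notin> set vs" by (simp_all add: count_list_0_iff)
    then have "word_perm (map (Pair i) us @ (i, a) # map (Pair i) vs) \<noteq> id"
      using i as by (intro word_perm_touched_once[of a]) (auto simp: touches_def)
    then show False using id as by simp
  qed
  \<comment> \<open>As every partner occurs at least twice, the length bound leaves no room for a
    third occurrence.\<close>
  have two: "count_list as a = 2" if a: "a \<in> set as" for a
  proof (rule ccontr)
    assume "count_list as a \<noteq> 2"
    with ge2[OF a] have "count_list as a > 2" by simp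
    then have "(\<Sum>b\<in>set as. 2) < (\<Sum>b\<in>set as. count_list as b)"
      using ge2 a by (intro sum_strict_mono_ex1) auto
    also have "\<dots> = length as" by (rule sum_count_set) auto
    finally show False using len by simp
  qed
  have "\<not> distinct as"
  proof
    assume "distinct as"
    moreover obtain a bs where "as = a # bs" using ne by (cases as) auto
    ultimately show False using two[of a] by (simp add: count_notin)
  qed
  then obtain us a bs vs where as: "as = us @ a # bs @ a # vs" and bs: "distinct bs" "a \<notin> set bs"
    using repeated_split_minimal by blast
  have "a \<notin> set us" "a \<notin> set vs" using two[of a] as bs by (auto simp: count_list_0_iff)
  \<comment> \<open>Follow \<open>a\<close> through the word from the right: the second
    \<open>a\<close> sends it to \<open>i\<close>, a nonempty \<open>bs\<close> sends
    \<open>i\<close> to \<open>b\<close>, and the first \<open>a\<close> fixes \<open>b\<close>. The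
    product being trivial, \<open>us\<close> would send both \<open>b\<close> and \<open>a\<close>
    to \<open>a\<close>.\<close>
  have "bs = []"
  proof (rule ccontr)
    assume "bs \<noteq> []"
    define b where "b = last bs"
    have b: "b \<in> set bs" "b \<noteq> a" "b \<noteq> i" using \<open>bs \<noteq> []\<close> bs i as by (auto simp: b_def)
    have "word_perm (map (Pair i) vs) a = a"
      using i as \<open>a \<notin> set vs\<close> by (intro word_perm_untouched) (auto simp: touches_def)
    moreover have "word_perm (map (Pair i) bs) i = b"
      unfolding b_def using i as bs \<open>bs \<noteq> []\<close> by (intro star_word_perm_distinct) auto
    ultimately have "word_perm (map (Pair i) as) a = word_perm (map (Pair i) us) b"
      using b by (simp add: as word_perm_append)
    moreover have "word_perm (map (Pair i) us) a = a"
      using i as \<open>a \<notin> set us\<close> by (intro word_perm_untouched) (auto simp: touches_def)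
    ultimately have "word_perm (map (Pair i) us) b = word_perm (map (Pair i) us) a" using id by simp
    with b(2) inj_word_perm show False by (metis injD)
  qed
  with as that show ?thesis by auto
qed

text \<open>The letters to the right of \<open>p\<close> fix \<open>i\<close> and those to its left
  fix \<open>j\<close>, so \<open>p\<close> itself would have to send \<open>i\<close> to
  \<open>j\<close>; but \<open>q\<close> is the only letter touching \<open>j\<close>.\<close>

lemma word_perm_not_swap:
  assumes "p \<noteq> q" "touches i p" "touches j q" "ts = as @ p # bs @ q # cs"
    and "\<forall>t\<in>set ts. touches i t \<longrightarrow> t = p" "\<forall>t\<in>set ts. touches j t \<longrightarrow> t = q"
    and "distinct ts" "word_perm ts i = j" "fst p \<noteq> snd p"
  shows False
proof -
  have d: "p \<notin> set bs" "p \<notin> set cs" "q \<notin> set as" using assms(4,7) by auto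
  have i: "\<not> touches i t" if "t \<in> set (bs @ q # cs)" for t
  proof
    assume "touches i t"
    moreover have "t \<in> set ts" using assms(4) that by auto
    ultimately have "t = p" using assms(5) by blast
    then show False using that d assms(1) by auto
  qed
  have j: "\<not> touches j t" if "t \<in> set as" for t
  proof
    assume "touches j t"
    moreover have "t \<in> set ts" using assms(4) that by auto
    ultimately have "t = q" using assms(6) by blast
    then show False using that d by auto
  qed
  have "word_perm (bs @ q # cs) i = i" using i by (intro word_perm_untouched) blast
  then have "word_perm as (transpose (fst p) (snd p) i) = j"
    using assms(8) unfolding assms(4) word_perm_append[of as] by simp
  moreover have "word_perm as j = j" using j by (intro word_perm_untouched) blast
  ultimately have "transpose (fst p) (snd p) i = j" using injD[OF inj_word_perm[of as]] by metis
  moreover have "transpose (fst p) (snd p) i \<in> {fst p, snd p}"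
    using assms(2) by (auto simp: touches_def)
  ultimately have "touches j p" by (auto simp: touches_def)
  moreover have "p \<in> set ts" using assms(4) by simp
  ultimately show False using assms(1,6) by blast
qed

text \<open>
  If the product is trivial, the graph with an edge from each centre to its partner is a
  disjoint union of cycles, and following the end points of the last letter shows that its
  cycle has length two.
\<close>
lemma distinct_centres_cancel:
  assumes dist: "distinct (map fst ts)" and proper: "\<forall>t\<in>set ts. fst t \<noteq> snd t"
    and id: "word_perm ts = id" and ne: "ts \<noteq> []"
  obtains us ms i j where "ts = us @ (j, i) # ms @ [(i, j)]"
    "\<forall>t\<in>set ms. \<not> touches i t \<and> \<not> touches j t"
proof -
  have d: "distinct ts" using dist by (simp add: distinct_map)
  have fst_inj: "s = t" if "s \<in> set ts" "t \<in> set ts" "fst s = fst t" for s t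
    using dist that by (metis distinct_map inj_onD)
  \<comment> \<open>A centre must be touched by a second letter; since the centres are distinct, it
    is the partner there.\<close>
  have sub: "fst ` set ts \<subseteq> snd ` set ts"
  proof
    fix x assume "x \<in> fst ` set ts"
    then obtain t where t: "t \<in> set ts" "x = fst t" by auto
    then obtain s where s: "s \<in> set ts" "s \<noteq> t" "touches x s"
      using touched_twice[OF id t(1) _ proper d] by (auto simp: touches_def)
    then have "x = snd s" using fst_inj[OF s(1) t(1)] t(2) by (auto simp: touches_def)
    with s show "x \<in> snd ` set ts" by auto
  qed
  have "card (fst ` set ts) = card (set ts)" using dist by (auto simp: distinct_map card_image)
  then have card: "card (set ts) \<le> card (snd ` set ts)" using card_mono[OF _ sub] by simp
  \<comment> \<open>Counting turns the inclusion into an equality: the partners are exactly the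
    centres, and each is the partner in one letter only.\<close>
  then have snd_eq: "card (snd ` set ts) = card (set ts)" using card_image_le[of "set ts" snd] by auto
  then have snd_inj: "inj_on snd (set ts)" by (intro eq_card_imp_inj_on) auto
  have img: "fst ` set ts = snd ` set ts"
    using sub snd_eq \<open>card (fst ` set ts) = card (set ts)\<close> by (intro card_subset_eq) auto
  obtain rs t where "ts = rs @ [t]" using ne by (cases ts rule: rev_cases) auto
  then obtain i j where ts: "ts = rs @ [(i, j)]" by (cases t) auto
  have ij: "i \<noteq> j" using proper ts by auto
  have only_i: "t = (i, j) \<or> snd t = i" if "t \<in> set ts" "touches i t" for t
    using that fst_inj[of t "(i, j)"] ts by (auto simp: touches_def)
  have only_j: "t = (i, j) \<or> fst t = j" if "t \<in> set ts" "touches j t" for t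
    using that inj_onD[OF snd_inj, of t "(i, j)"] ts by (auto simp: touches_def)
  obtain l where l: "(l, i) \<in> set ts" using sub ts by fastforce
  obtain k where k: "(j, k) \<in> set ts" using img ts by fastforce
  have lk: "(l, i) \<in> set rs" "(j, k) \<in> set rs" using l k ts ij by auto
  have only_i': "t = (l, i)" if "t \<in> set rs" "touches i t" for t
    using only_i[of t] that inj_onD[OF snd_inj, of t "(l, i)"] l ts d by auto
  have only_j': "t = (j, k)" if "t \<in> set rs" "touches j t" for t
    using only_j[of t] that fst_inj[of t "(j, k)"] k ts d by auto
  show ?thesis
  proof (cases "(l, i) = (j, k)")
    case True
    then obtain us ms where rs: "rs = us @ (j, i) # ms" using lk split_list by fastforce
    have "\<not> touches i t \<and> \<not> touches j t" if "t \<in> set ms" for t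
    proof -
      have "t \<noteq> (j, i)" using that d ts rs by auto
      moreover have "t \<in> set rs" using that rs by simp
      ultimately show ?thesis using only_i'[of t] only_j'[of t] True by auto
    qed
    with that rs ts show ?thesis by auto
  next
    case False
    \<comment> \<open>Cancelling the last letter \<open>(i, j)\<close> leaves \<open>rs\<close>,
      which exchanges \<open>i\<close> and \<open>j\<close>. Each of them is touched by one letter
      of \<open>rs\<close>; whichever letter comes first, \<open>word_perm_not_swap\<close> rules
      this out.\<close>
    have inv: "word_perm rs (transpose i j x) = x" for x
      using fun_cong[OF id, of x] by (simp add: ts word_perm_append)
    have ji: "word_perm rs j = i" "word_perm rs i = j" using inv[of i] inv[of j] by auto
    have drs: "distinct rs" using d ts by simp
    have li: "fst (l, i) \<noteq> snd (l, i)" and jk: "fst (j, k) \<noteq> snd (j, k)" using l k proper by auto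
    have ti: "touches i (l, i)" and tj: "touches j (j, k)" by (simp_all add: touches_def)
    have oi: "\<forall>t\<in>set rs. touches i t \<longrightarrow> t = (l, i)" and oj: "\<forall>t\<in>set rs. touches j t \<longrightarrow> t = (j, k)"
      using only_i' only_j' by blast+
    obtain as cs where rs: "rs = as @ (l, i) # cs" using split_list[OF lk(1)] by blast
    then consider "(j, k) \<in> set as" | "(j, k) \<in> set cs" using lk(2) False by auto
    then have False
    proof cases
      case 1
      then obtain bs ds where "as = bs @ (j, k) # ds" using split_list by fast
      then have "rs = bs @ (j, k) # ds @ (l, i) # cs" using rs by simp
      from word_perm_not_swap[OF _ tj ti this oj oi drs ji(1) jk] False show False by blast
    next
      case 2
      then obtain bs ds where "cs = bs @ (j, k) # ds" using split_list by fast
      then have "rs = as @ (l, i) # bs @ (j, k) # ds" using rs by simp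
      from word_perm_not_swap[OF False ti tj this oi oj drs ji(2) li] show False .
    qed
    then show ?thesis ..
  qed
qed

section \<open>Additive operators and Clifford multiplication\<close>

text \<open>
  A state records a degree, a permutation and the set of Clifford generators of a monomial.
\<close>
type_synonym state = "nat \<times> (nat \<Rightarrow> nat) \<times> nat set"

text \<open>Only additivity is required, because \<open>Zop\<close> below multiplies values on the
  left in a noncommutative ring. As a type, the maps form an instance of \<open>ring_1\<close> with
  composition as product.\<close>

typedef (overloaded) 'p opr = "{f :: (state \<Rightarrow> 'p::ring_1) \<Rightarrow> state \<Rightarrow> 'p.
    \<forall>u v. f (\<lambda>x. u x + v x) = (\<lambda>x. f u x + f v x)}"
  morphisms app Opr
  by (rule exI[of _ id]) auto

setup_lifting type_definition_opr

lemma app_add: "app f (\<lambda>x. u x + v x) = (\<lambda>x. app f u x + app f v x)"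
  using app[of f] by blast

lemma app_zero: "app f (\<lambda>_. 0) = (\<lambda>_. 0)"
proof
  fix x
  have "app f (\<lambda>_. 0) x + app f (\<lambda>_. 0) x = app f (\<lambda>_. 0) x"
    using fun_cong[OF app_add[of f "\<lambda>_. 0" "\<lambda>_. 0"], of x] by simp
  then show "app f (\<lambda>_. 0) x = 0" by simp
qed

instantiation opr :: (ring_1) ring_1
begin

lift_definition zero_opr :: "'a opr" is "\<lambda>_ _. 0" by simp
lift_definition one_opr :: "'a opr" is "\<lambda>v. v" by simp
lift_definition plus_opr :: "'a opr \<Rightarrow> 'a opr \<Rightarrow> 'a opr" is "\<lambda>f g v x. f v x + g v x"
  by (auto simp: algebra_simps)
lift_definition uminus_opr :: "'a opr \<Rightarrow> 'a opr" is "\<lambda>f v x. - f v x" by auto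
lift_definition minus_opr :: "'a opr \<Rightarrow> 'a opr \<Rightarrow> 'a opr" is "\<lambda>f g v x. f v x - g v x"
  by (auto simp: algebra_simps)
lift_definition times_opr :: "'a opr \<Rightarrow> 'a opr \<Rightarrow> 'a opr" is "\<lambda>f g v. f (g v)" by simp

instance
proof
  fix a b c :: "'a opr"
  show "a * b * c = a * (b * c)" by transfer simp
  show "1 * a = a" "a * 1 = a" by (transfer; simp)+
  show "a + b + c = a + (b + c)" by transfer (simp add: algebra_simps)
  show "a + b = b + a" by transfer (simp add: algebra_simps)
  show "0 + a = a" by transfer simp
  show "- a + a = 0" by transfer simp
  show "a - b = a + - b" by transfer simp
  show "(a + b) * c = a * c + b * c" by transfer simp
  show "a * (b + c) = a * b + a * c" by transfer simp
  show "(0 :: 'a opr) \<noteq> 1"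
  proof
    assume "(0 :: 'a opr) = 1"
    then have "app (0 :: 'a opr) (\<lambda>_. 1) undefined = app 1 (\<lambda>_. 1) undefined" by simp
    then show False by (simp add: zero_opr.rep_eq one_opr.rep_eq)
  qed
qed

end

lemmas app_simps = zero_opr.rep_eq one_opr.rep_eq plus_opr.rep_eq uminus_opr.rep_eq
  minus_opr.rep_eq times_opr.rep_eq

lemma app_sum: "app (sum F S) v x = (\<Sum>s\<in>S. app (F s) v x)"
  by (induction S rule: infinite_finite_induct) (auto simp: app_simps)

lemma app_of_nat: "app (of_nat k) v x = of_nat k * v x"
  by (induction k) (auto simp: app_simps algebra_simps)

text \<open>
  The transpose of left multiplication by the \<open>b\<close>-th generator of the Clifford algebra in which
  the generators anticommute and the square of the \<open>b\<close>-th is \<open>H b\<close>: here \<open>f T\<close> is the value of a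
  functional at the product of the generators in \<open>T\<close>.
\<close>
definition clif_coeff :: "(nat \<Rightarrow> int) \<Rightarrow> nat \<Rightarrow> nat set \<Rightarrow> int" where
  "clif_coeff H b T = (- 1) ^ card {t \<in> T. t < b} * (if b \<in> T then H b else 1)"

definition clif :: "(nat \<Rightarrow> int) \<Rightarrow> nat \<Rightarrow> (nat set \<Rightarrow> 'p) \<Rightarrow> nat set \<Rightarrow> 'p::ring_1" where
  "clif H b f T = of_int (clif_coeff H b T) * f (sym_diff T {b})"

lemma clif_coeff_square: "clif_coeff H b T * clif_coeff H b (sym_diff T {b}) = H b"
proof -
  have "{t \<in> sym_diff T {b}. t < b} = {t \<in> T. t < b}" by auto
  then show ?thesis by (auto simp: clif_coeff_def simp flip: power_mult_distrib)
qed

lemma clif_coeff_toggle_below: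
  assumes "a < b" shows "clif_coeff H b (sym_diff T {a}) = - clif_coeff H b T"
proof -
  have "(- 1 :: int) ^ card {t \<in> sym_diff T {a}. t < b} = - ((- 1) ^ card {t \<in> T. t < b})"
  proof (cases "a \<in> T")
    case True
    then have "{t \<in> T. t < b} = insert a {t \<in> sym_diff T {a}. t < b}" using assms by auto
    moreover have "a \<notin> {t \<in> sym_diff T {a}. t < b}" using True by simp
    ultimately have "card {t \<in> T. t < b} = Suc (card {t \<in> sym_diff T {a}. t < b})"
      by (simp only: card_insert_disjoint finite_Collect_conjI finite_Collect_less_nat simp_thms)
    then show ?thesis by simp
  next
    case False
    then have "{t \<in> sym_diff T {a}. t < b} = insert a {t \<in> T. t < b}" using assms by auto
    then show ?thesis using False by simp
  qed
  moreover have "b \<in> sym_diff T {a} \<longleftrightarrow> b \<in> T" using assms by auto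
  ultimately show ?thesis by (simp add: clif_coeff_def)
qed

lemma clif_coeff_toggle_above:
  assumes "b < a" shows "clif_coeff H b (sym_diff T {a}) = clif_coeff H b T"
proof -
  have "{t \<in> sym_diff T {a}. t < b} = {t \<in> T. t < b}" using assms by auto
  moreover have "b \<in> sym_diff T {a} \<longleftrightarrow> b \<in> T" using assms by auto
  ultimately show ?thesis by (simp add: clif_coeff_def)
qed

text \<open>Exactly one of the two indices lies below the other, so exactly one of the two toggles
  changes a sign.\<close>

lemma clif_coeff_anticommute:
  assumes "a \<noteq> b"
  shows "clif_coeff H a T * clif_coeff H b (sym_diff T {a}) = - (clif_coeff H b T * clif_coeff H a (sym_diff T {b}))"
  using assms by (cases "a < b") (auto simp: clif_coeff_toggle_below clif_coeff_toggle_above)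

lemma sym_diff_commute: "sym_diff (sym_diff T {a}) {b} = sym_diff (sym_diff T {b}) {a}"
  by auto

lemma sym_diff_cancel: "sym_diff (sym_diff T {a}) {a} = T"
  by auto

lemma clif_add: "clif H b (\<lambda>T. u T + v T) T = clif H b u T + clif H b v T"
  by (simp add: clif_def algebra_simps)

lemma clif_square: "clif H b (clif H b f) T = of_int (H b) * f T"
  by (simp add: clif_def sym_diff_cancel clif_coeff_square mult.assoc[symmetric] flip: of_int_mult)

lemma clif_anticommute:
  assumes "a \<noteq> b" shows "clif H a (clif H b f) T = - clif H b (clif H a f) T"
  using clif_coeff_anticommute[OF assms, of H T]
  by (simp add: clif_def sym_diff_commute[of T a b] mult.assoc[symmetric] flip: of_int_mult)

text \<open>Toggling \<open>0\<close> changes the number of generators below \<open>b\<close> by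
  one, hence the sign; the factor \<open>p\<close> commutes with the integer coefficient.\<close>

lemma clif_parity:
  assumes "0 < b" shows "clif H b (\<lambda>T. p * f (sym_diff T {0})) T = - (p * clif H b f (sym_diff T {0}))"
proof -
  have "of_int k * (p * q) = p * (of_int k * q)" for k and q
    by (metis mult.assoc mult_of_int_commute)
  then show ?thesis using clif_coeff_toggle_below[OF assms, of H T]
    by (simp add: clif_def sym_diff_commute[of T 0 b])
qed

section \<open>Operators representing the extended algebra\<close>

text \<open>
  The algebra is given by a ring, a subring \<open>C\<close>, an ideal \<open>I\<close> of \<open>C\<close> and the generators
  \<open>z i j\<close>, and all relations hold modulo \<open>I\<close>. The index \<open>w\<close> belongs to the Clifford generator \<open>\<tau>\<close>.
\<close>
locale anticomm_quad =
  fixes V :: "nat set" and w :: nat and C I :: "'p::ring_1 set" and z :: "nat \<Rightarrow> nat \<Rightarrow> 'p"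
  assumes finite_V: "finite V" and V_pos: "0 \<notin> V" and w_pos: "0 < w" and w_V: "w \<notin> V"
    and C_of_int: "of_int m \<in> C"
    and C_add: "p \<in> C \<Longrightarrow> q \<in> C \<Longrightarrow> p + q \<in> C"
    and C_mult: "p \<in> C \<Longrightarrow> q \<in> C \<Longrightarrow> p * q \<in> C"
    and I_zero: "0 \<in> I"
    and I_add: "p \<in> I \<Longrightarrow> q \<in> I \<Longrightarrow> p + q \<in> I"
    and I_left: "p \<in> C \<Longrightarrow> q \<in> I \<Longrightarrow> p * q \<in> I"
    and I_right: "p \<in> I \<Longrightarrow> q \<in> C \<Longrightarrow> p * q \<in> I"
    and I_torsion: "m \<noteq> 0 \<Longrightarrow> of_int m * p \<in> I \<Longrightarrow> p \<in> I"
    and z_C: "i \<in> V \<Longrightarrow> j \<in> V \<Longrightarrow> i \<noteq> j \<Longrightarrow> z i j \<in> C"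
    and z_sym: "z i j = z j i"
    and z_square: "i \<in> V \<Longrightarrow> j \<in> V \<Longrightarrow> i \<noteq> j \<Longrightarrow> z i j * z i j \<in> I"
    and z_disjoint: "\<lbrakk>i \<in> V; j \<in> V; k \<in> V; l \<in> V; i \<noteq> j; k \<noteq> l; {i, j} \<inter> {k, l} = {}\<rbrakk>
      \<Longrightarrow> z i j * z k l + z k l * z i j \<in> I"
    and z_triangle: "\<lbrakk>i \<in> V; j \<in> V; k \<in> V; i \<noteq> j; j \<noteq> k; i \<noteq> k\<rbrakk>
      \<Longrightarrow> z i j * z j k + z j k * z k i + z k i * z i j \<in> I"
begin

lemma C_zero: "0 \<in> C" and C_one: "1 \<in> C"
  using C_of_int[of 0] C_of_int[of 1] by simp_all

lemma C_uminus: "p \<in> C \<Longrightarrow> - p \<in> C"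
  using C_mult[OF C_of_int[of "-1"], of p] by simp

lemma I_uminus: "p \<in> I \<Longrightarrow> - p \<in> I"
  using I_left[OF C_of_int[of "-1"], of p] by simp

lemma I_sum: "(\<And>s. s \<in> S \<Longrightarrow> F s \<in> I) \<Longrightarrow> sum F S \<in> I"
  by (induction S rule: infinite_finite_induct) (auto intro: I_zero I_add)

text \<open>An index in \<open>V\<close> is its own weight, so that the squares of the corresponding
  generators are pairwise distinct integers; the generators \<open>0\<close> and \<open>w\<close>
  square to zero.\<close>

definition weight :: "nat \<Rightarrow> int" where
  "weight b = (if b \<in> V then int b else 0)"

abbreviation cl :: "nat \<Rightarrow> (nat set \<Rightarrow> 'p) \<Rightarrow> nat set \<Rightarrow> 'p" where
  "cl \<equiv> clif weight"

text \<open>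
  The Clifford generator \<open>0\<close> has weight \<open>0\<close> and, being smaller than all others, anticommutes with
  every \<open>Aop k\<close> up to the permutation; it supplies the sign in \<open>(ij) A\<^sub>k = - A\<^bsub>s(k)\<^esub> (ij)\<close>. The
  parameter \<open>A\<^sub>i\<close> acts at the permutation \<open>g\<close> as the generator \<open>g i\<close> plus \<open>\<tau>\<close>, so that its
  square is \<open>g i\<close>.
\<close>
definition Zop :: "nat \<Rightarrow> nat \<Rightarrow> 'p opr" where
  "Zop i j = Opr (\<lambda>v (d, g, T). case d of 0 \<Rightarrow> 0
     | Suc d' \<Rightarrow> z i j * v (d', g \<circ> transpose i j, sym_diff T {0}))"

definition Aop :: "nat \<Rightarrow> 'p opr" where
  "Aop i = Opr (\<lambda>v (d, g, T). cl (g i) (\<lambda>S. v (d, g, S)) T + cl w (\<lambda>S. v (d, g, S)) T)"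

lemma app_Zop: "app (Zop i j) v (d, g, T) =
    (case d of 0 \<Rightarrow> 0 | Suc d' \<Rightarrow> z i j * v (d', g \<circ> transpose i j, sym_diff T {0}))"
  unfolding Zop_def by (subst Opr_inverse) (auto simp: fun_eq_iff algebra_simps split: nat.splits)

lemma app_Zop_simps [simp]:
  "app (Zop i j) v (0, g, T) = 0"
  "app (Zop i j) v (Suc d, g, T) = z i j * v (d, g \<circ> transpose i j, sym_diff T {0})"
  by (simp_all add: app_Zop)

lemma app_Aop: "app (Aop i) v (d, g, T) =
    cl (g i) (\<lambda>S. v (d, g, S)) T + cl w (\<lambda>S. v (d, g, S)) T"
  unfolding Aop_def by (subst Opr_inverse) (auto simp: fun_eq_iff clif_add algebra_simps)

lemma Zop_sym: "Zop i j = Zop j i"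
  unfolding Zop_def by (simp only: z_sym[of i j] transpose_commute[of i j])

abbreviation good :: "(nat \<Rightarrow> nat) \<Rightarrow> bool" where
  "good g \<equiv> g permutes V"

lemma good_transpose: "i \<in> V \<Longrightarrow> j \<in> V \<Longrightarrow> good (g \<circ> transpose i j) \<longleftrightarrow> good g"
proof
  assume ij: "i \<in> V" "j \<in> V"
  then have t: "good (transpose i j)" by (rule permutes_swap_id)
  show "good g \<Longrightarrow> good (g \<circ> transpose i j)" using t by (rule permutes_compose)
  assume "good (g \<circ> transpose i j)"
  then have "good ((g \<circ> transpose i j) \<circ> transpose i j)"
    using permutes_compose[OF t] by blast
  moreover have "(g \<circ> transpose i j) \<circ> transpose i j = g" by (simp add: fun_eq_iff)
  ultimately show "good g" by simp
qed

text \<open>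
  \<open>supp e\<close> consists of the functions on states starting in degree \<open>e\<close>, \<open>null D\<close> of those vanishing
  modulo \<open>I\<close> below degree \<open>D\<close>, and \<open>small d\<close> of the operators whose components raising the
  degree by less than \<open>d\<close> vanish modulo \<open>I\<close>.
\<close>
definition supp :: "nat \<Rightarrow> (state \<Rightarrow> 'p) set" where
  "supp e = {v. \<forall>d g T. v (d, g, T) \<in> C \<and> (d < e \<or> \<not> good g \<longrightarrow> v (d, g, T) = 0)}"

definition null :: "nat \<Rightarrow> (state \<Rightarrow> 'p) set" where
  "null D = {v. \<forall>d g T. d < D \<longrightarrow> good g \<longrightarrow> v (d, g, T) \<in> I}"

definition small :: "nat \<Rightarrow> 'p opr set" where
  "small d = {f. \<forall>e. \<forall>v\<in>supp e. app f v \<in> null (e + d)}"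

definition negl :: "'p opr set" where
  "negl = {f. \<forall>d. f \<in> small d}"

definition ops :: "nat \<Rightarrow> 'p opr set" where
  "ops r = {h. (\<forall>e. \<forall>v\<in>supp e. app h v \<in> supp (e + r)) \<and> (\<forall>D. \<forall>v\<in>null D. app h v \<in> null (D + r))}"

section \<open>Stability of the degree filtration under sums and composition\<close>

lemma supp_antimono: "e \<le> e' \<Longrightarrow> supp e' \<subseteq> supp e"
  by (fastforce simp: supp_def)

lemma null_antimono: "e \<le> e' \<Longrightarrow> null e' \<subseteq> null e"
  by (fastforce simp: null_def)

lemma ops_antimono:
  assumes "r \<le> s" shows "ops s \<subseteq> ops r"
proof
  fix h assume h: "h \<in> ops s"
  have "supp (e + s) \<subseteq> supp (e + r)" "null (e + s) \<subseteq> null (e + r)" for e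
    using assms by (intro supp_antimono null_antimono; simp)+
  with h show "h \<in> ops r" unfolding ops_def by blast
qed

lemma supp_add: "u \<in> supp e \<Longrightarrow> v \<in> supp e \<Longrightarrow> (\<lambda>x. u x + v x) \<in> supp e"
  by (auto simp: supp_def C_add)

lemma supp_uminus: "v \<in> supp e \<Longrightarrow> (\<lambda>x. - v x) \<in> supp e"
  by (auto simp: supp_def C_uminus)

lemma null_add: "u \<in> null e \<Longrightarrow> v \<in> null e \<Longrightarrow> (\<lambda>x. u x + v x) \<in> null e"
  by (auto simp: null_def I_add)

lemma null_uminus: "v \<in> null e \<Longrightarrow> (\<lambda>x. - v x) \<in> null e"
  by (auto simp: null_def I_uminus)

lemma supp_zero: "(\<lambda>x. 0) \<in> supp e" and null_zero: "(\<lambda>x. 0) \<in> null e"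
  by (auto simp: supp_def C_zero null_def I_zero)

lemma ops_zero: "0 \<in> ops r"
  by (simp add: ops_def zero_opr.rep_eq supp_zero null_zero)

lemma ops_one: "1 \<in> ops 0"
  by (simp add: ops_def one_opr.rep_eq)

lemma ops_add: "f \<in> ops r \<Longrightarrow> g \<in> ops r \<Longrightarrow> f + g \<in> ops r"
  by (simp add: ops_def plus_opr.rep_eq supp_add null_add)

lemma ops_uminus: "f \<in> ops r \<Longrightarrow> - f \<in> ops r"
  by (simp add: ops_def uminus_opr.rep_eq supp_uminus null_uminus)

lemma ops_diff: "f \<in> ops r \<Longrightarrow> g \<in> ops r \<Longrightarrow> f - g \<in> ops r"
  using ops_add[OF _ ops_uminus, of f r g] by simp

lemma ops_mult: "f \<in> ops r \<Longrightarrow> g \<in> ops s \<Longrightarrow> f * g \<in> ops (r + s)"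
  unfolding ops_def times_opr.rep_eq mem_Collect_eq add.commute[of r s] add.assoc[symmetric] by blast

lemma ops_mult0: "f \<in> ops 0 \<Longrightarrow> g \<in> ops 0 \<Longrightarrow> f * g \<in> ops 0"
  using ops_mult[of f 0 g 0] by simp

lemma ops_sum: "(\<And>s. s \<in> S \<Longrightarrow> F s \<in> ops r) \<Longrightarrow> sum F S \<in> ops r"
  by (induction S rule: infinite_finite_induct) (auto intro: ops_zero ops_add)

lemma ops_power: "f \<in> ops 0 \<Longrightarrow> f ^ k \<in> ops 0"
  by (induction k) (auto intro: ops_one ops_mult0)

lemma ops_prod_list: "(\<And>f. f \<in> set fs \<Longrightarrow> f \<in> ops 0) \<Longrightarrow> prod_list fs \<in> ops 0"
  by (induction fs) (auto intro: ops_one ops_mult0)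

lemma ops_of_nat: "of_nat k \<in> ops 0"
  by (induction k) (auto intro: ops_zero ops_one ops_add)

lemma ops_of_int: "of_int k \<in> ops 0"
  by (cases k rule: int_diff_cases) (simp add: ops_of_nat ops_diff)

lemma small_add: "f \<in> small d \<Longrightarrow> g \<in> small d \<Longrightarrow> f + g \<in> small d"
  by (simp add: small_def plus_opr.rep_eq null_add)

lemma small_uminus: "f \<in> small d \<Longrightarrow> - f \<in> small d"
  by (simp add: small_def uminus_opr.rep_eq null_uminus)

lemma small_diff: "f \<in> small d \<Longrightarrow> g \<in> small d \<Longrightarrow> f - g \<in> small d"
  using small_add[OF _ small_uminus, of f d g] by simp

lemma small_left: "f \<in> small d \<Longrightarrow> h \<in> ops r \<Longrightarrow> h * f \<in> small (d + r)"
  unfolding small_def ops_def times_opr.rep_eq mem_Collect_eq add.assoc[symmetric] by blast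

lemma small_right: "f \<in> small d \<Longrightarrow> h \<in> ops r \<Longrightarrow> f * h \<in> small (d + r)"
  unfolding small_def ops_def times_opr.rep_eq mem_Collect_eq add.commute[of d r] add.assoc[symmetric]
  by blast

lemma negl_small: "f \<in> negl \<Longrightarrow> f \<in> small d"
  by (simp add: negl_def)

lemma negl_zero: "0 \<in> negl"
  by (simp add: negl_def small_def zero_opr.rep_eq null_zero)

lemma negl_add: "f \<in> negl \<Longrightarrow> g \<in> negl \<Longrightarrow> f + g \<in> negl"
  by (simp add: negl_def small_add)

lemma negl_uminus: "f \<in> negl \<Longrightarrow> - f \<in> negl"
  by (simp add: negl_def small_uminus)

lemma negl_diff: "f \<in> negl \<Longrightarrow> g \<in> negl \<Longrightarrow> f - g \<in> negl"
  by (simp add: negl_def small_diff)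

lemma negl_left: "h \<in> ops 0 \<Longrightarrow> f \<in> negl \<Longrightarrow> h * f \<in> negl"
  using small_left[of f _ h 0] by (simp add: negl_def)

lemma negl_right: "f \<in> negl \<Longrightarrow> h \<in> ops 0 \<Longrightarrow> f * h \<in> negl"
  using small_right[of f _ h 0] by (simp add: negl_def)

lemma negl_sum: "(\<And>s. s \<in> S \<Longrightarrow> F s \<in> negl) \<Longrightarrow> sum F S \<in> negl"
  by (induction S rule: infinite_finite_induct) (auto intro: negl_zero negl_add)

lemma neglI:
  assumes "\<And>v d g T. (\<And>x. v x \<in> C) \<Longrightarrow> good g \<Longrightarrow> app f v (d, g, T) \<in> I"
  shows "f \<in> negl"
proof -
  have "v x \<in> C" if "v \<in> supp e" for v e x using that by (cases x) (auto simp: supp_def)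
  then show ?thesis using assms by (fastforce simp: negl_def small_def null_def)
qed

lemma negl_app: "f \<in> negl \<Longrightarrow> v \<in> supp 0 \<Longrightarrow> good g \<Longrightarrow> app f v (d, g, T) \<in> I"
  by (force simp: negl_def small_def null_def)

lemma negl_torsion:
  assumes "k \<noteq> 0" "of_nat k * f \<in> negl" shows "f \<in> negl"
proof -
  have "app f v (d, g, T) \<in> I" if "v \<in> supp e" "d < e + m" "good g" for v e m d g T
  proof -
    have "of_nat k * app f v (d, g, T) \<in> I"
      using assms(2) that by (force simp: negl_def small_def null_def times_opr.rep_eq app_of_nat)
    then show ?thesis using assms(1) I_torsion[of "int k"] by simp
  qed
  then show ?thesis by (auto simp: negl_def small_def null_def)
qed

section \<open>Equality of operators modulo negligible ones\<close>

definition eqv :: "'p opr \<Rightarrow> 'p opr \<Rightarrow> bool" (infix "\<approx>" 50) where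
  "f \<approx> g \<longleftrightarrow> f - g \<in> negl"

lemma eqv_refl [simp]: "f \<approx> f"
  by (simp add: eqv_def negl_zero)

lemma eqv_sym: "f \<approx> g \<Longrightarrow> g \<approx> f"
  using negl_uminus[of "f - g"] by (simp add: eqv_def)

lemma eqv_trans [trans]: "f \<approx> g \<Longrightarrow> g \<approx> h \<Longrightarrow> f \<approx> h"
  using negl_add[of "f - g" "g - h"] by (simp add: eqv_def)

lemma eqv_add: "f \<approx> f' \<Longrightarrow> g \<approx> g' \<Longrightarrow> f + g \<approx> f' + g'"
  using negl_add[of "f - f'" "g - g'"] by (simp add: eqv_def algebra_simps)

lemma eqv_uminus: "f \<approx> f' \<Longrightarrow> - f \<approx> - f'"
  using negl_uminus[of "f - f'"] by (simp add: eqv_def)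

lemma eqv_diff: "f \<approx> f' \<Longrightarrow> g \<approx> g' \<Longrightarrow> f - g \<approx> f' - g'"
  using eqv_add[OF _ eqv_uminus, of f f' g g'] by simp

lemma eqv_mult: "f \<approx> f' \<Longrightarrow> g \<approx> g' \<Longrightarrow> f' \<in> ops 0 \<Longrightarrow> g \<in> ops 0 \<Longrightarrow> f * g \<approx> f' * g'"
  using negl_add[OF negl_right[of "f - f'" g] negl_left[of f' "g - g'"]]
  by (simp add: eqv_def algebra_simps)

lemma eqv_left: "h \<in> ops 0 \<Longrightarrow> f \<approx> g \<Longrightarrow> h * f \<approx> h * g"
  using negl_left[of h "f - g"] by (simp add: eqv_def algebra_simps)

lemma eqv_right: "f \<approx> g \<Longrightarrow> h \<in> ops 0 \<Longrightarrow> f * h \<approx> g * h"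
  using negl_right[of "f - g" h] by (simp add: eqv_def algebra_simps)

lemma eqv_sum: "(\<And>s. s \<in> S \<Longrightarrow> F s \<approx> G s) \<Longrightarrow> sum F S \<approx> sum G S"
  using negl_sum[of S "\<lambda>s. F s - G s"] by (simp add: eqv_def sum_subtractf)

lemma eqv_zero_iff: "f \<approx> 0 \<longleftrightarrow> f \<in> negl"
  by (simp add: eqv_def)

section \<open>Relations between the parameters and the transpositions\<close>

lemma clif_C: "(\<And>T. f T \<in> C) \<Longrightarrow> cl b f T \<in> C"
  by (simp add: clif_def C_mult C_of_int)

lemma clif_I: "(\<And>T. f T \<in> I) \<Longrightarrow> cl b f T \<in> I"
  by (simp add: clif_def I_left C_of_int)

lemma clif_zero: "(\<And>T. f T = 0) \<Longrightarrow> cl b f T = 0"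
  by (simp add: clif_def)

lemma Aop_ops: "Aop i \<in> ops 0"
  by (auto simp: ops_def supp_def null_def app_Aop clif_C clif_I clif_zero C_add I_add)

lemma Zop_ops: "i \<in> V \<Longrightarrow> j \<in> V \<Longrightarrow> i \<noteq> j \<Longrightarrow> Zop i j \<in> ops 1"
  unfolding ops_def supp_def null_def app_Zop mem_Collect_eq good_transpose
  by (auto simp: app_Zop good_transpose z_C C_mult C_zero I_zero intro!: I_left split: nat.splits)

lemma Zop_ops0: "i \<in> V \<Longrightarrow> j \<in> V \<Longrightarrow> i \<noteq> j \<Longrightarrow> Zop i j \<in> ops 0"
  using Zop_ops ops_antimono[of 0 1] by blast

lemma good_inj: "good g \<Longrightarrow> i \<noteq> j \<Longrightarrow> g i \<noteq> g j"
  using permutes_inj by (metis injD)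

lemma good_range: "good g \<Longrightarrow> i \<in> V \<Longrightarrow> g i \<in> V"
  by (simp add: permutes_in_image)

text \<open>The generators \<open>g i\<close>, \<open>g j\<close> and \<open>w\<close> are distinct
  and anticommute, so only twice the square of \<open>w\<close> remains, which is zero.\<close>

lemma Aop_anticommute:
  assumes "i \<in> V" "j \<in> V" "i \<noteq> j"
  shows "Aop i * Aop j + Aop j * Aop i \<in> negl"
proof (rule neglI)
  fix v d g T assume g: "good g"
  have "g i \<noteq> w" "g j \<noteq> w" using good_range[OF g] assms w_V by auto
  then show "app (Aop i * Aop j + Aop j * Aop i) v (d, g, T) \<in> I"
    using clif_anticommute[OF good_inj[OF g assms(3)], of weight "\<lambda>S. v (d, g, S)" T]
      clif_anticommute[of "g i" w weight "\<lambda>S. v (d, g, S)" T]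
      clif_anticommute[of "g j" w weight "\<lambda>S. v (d, g, S)" T]
    by (simp add: app_simps app_Aop clif_add clif_square weight_def w_V I_zero)
qed

lemma app_Aop_square:
  assumes "good g" "i \<in> V"
  shows "app (Aop i * Aop i) v (d, g, T) = of_nat (g i) * v (d, g, T)"
proof -
  have "g i \<noteq> w" "g i \<in> V" using good_range[OF assms] w_V by auto
  then show ?thesis
    using clif_anticommute[of "g i" w weight "\<lambda>S. v (d, g, S)" T]
    by (simp add: app_simps app_Aop clif_add clif_square weight_def w_V)
qed

text \<open>Both products use the generator \<open>g (transpose i j k)\<close>: one reads
  \<open>Aop k\<close> at \<open>g \<circ> transpose i j\<close>, the other reads
  \<open>Aop (transpose i j k)\<close> at \<open>g\<close>. Toggling \<open>0\<close> supplies the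
  sign.\<close>

lemma Zop_Aop:
  assumes "i \<in> V" "j \<in> V" "k \<in> V"
  shows "Zop i j * Aop k + Aop (transpose i j k) * Zop i j \<in> negl"
proof (rule neglI)
  fix v d g T assume g: "good g"
  have "transpose i j k \<in> V" using assms by (auto simp: transpose_def)
  then have "g (transpose i j k) \<in> V" using good_range[OF g] by blast
  then have pos: "0 < g (transpose i j k)" using V_pos by (metis gr0I)
  show "app (Zop i j * Aop k + Aop (transpose i j k) * Zop i j) v (d, g, T) \<in> I"
  proof (cases d)
    case 0 then show ?thesis by (simp add: app_simps app_Aop clif_zero I_zero)
  next
    case (Suc d')
    then show ?thesis
      using clif_parity[OF pos, of weight "z i j" "\<lambda>S. v (d', g \<circ> transpose i j, S)" T]
        clif_parity[OF w_pos, of weight "z i j" "\<lambda>S. v (d', g \<circ> transpose i j, S)" T]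
      by (simp add: app_simps app_Aop I_zero distrib_left)
  qed
qed

lemma app_Zop_Zop: "app (Zop i j * Zop k l) v (Suc (Suc d), g, T) =
    z i j * z k l * v (d, g \<circ> (transpose i j \<circ> transpose k l), T)"
  by (simp add: app_simps mult.assoc o_assoc sym_diff_cancel)

lemma Zop_square:
  assumes "i \<in> V" "j \<in> V" "i \<noteq> j" shows "Zop i j * Zop i j \<in> negl"
proof (rule neglI)
  fix v d g T assume v: "\<And>x :: state. v x \<in> C"
  show "app (Zop i j * Zop i j) v (d, g, T) \<in> I"
    using z_square[OF assms] v app_Zop_Zop[of i j i j]
    by (cases d; cases "d - 1") (simp_all add: times_opr.rep_eq I_zero I_right)
qed

lemma app_Zop_pair: "app (Zop i j * Zop k l) v (d, g, T) =
    (if d < 2 then 0 else z i j * z k l * v (d - 2, g \<circ> (transpose i j \<circ> transpose k l), T))"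
proof (cases "d < 2")
  case True
  then show ?thesis by (cases d) (auto simp: times_opr.rep_eq less_Suc_eq)
next
  case False
  then obtain d' where "d = Suc (Suc d')" by (metis One_nat_def Suc_1 less_Suc0 less_Suc_eq_0_disj not0_implies_Suc)
  then show ?thesis by (simp only: app_Zop_Zop) simp
qed

lemma Zop_disjoint:
  assumes "i \<in> V" "j \<in> V" "k \<in> V" "l \<in> V" "i \<noteq> j" "k \<noteq> l" "{i, j} \<inter> {k, l} = {}"
  shows "Zop i j * Zop k l + Zop k l * Zop i j \<in> negl"
proof (rule neglI)
  fix v d g T assume v: "\<And>x :: state. v x \<in> C"
  have t: "transpose k l \<circ> transpose i j = transpose i j \<circ> transpose k l"
    using assms(7) by (auto simp: fun_eq_iff transpose_def)
  show "app (Zop i j * Zop k l + Zop k l * Zop i j) v (d, g, T) \<in> I"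
    using I_right[OF z_disjoint[OF assms] v]
    by (simp only: plus_opr.rep_eq app_Zop_pair t) (auto simp: I_zero simp flip: distrib_right)
qed

text \<open>All three products carry the same permutation, so they multiply one common value and the
  relation for \<open>z\<close> applies.\<close>

lemma Zop_triangle:
  assumes "i \<in> V" "j \<in> V" "k \<in> V" "i \<noteq> j" "j \<noteq> k" "i \<noteq> k"
  shows "Zop i j * Zop j k + Zop j k * Zop k i + Zop k i * Zop i j \<in> negl"
proof (rule neglI)
  fix v d g T assume v: "\<And>x :: state. v x \<in> C"
  have t: "transpose j k \<circ> transpose k i = transpose i j \<circ> transpose j k"
    "transpose k i \<circ> transpose i j = transpose i j \<circ> transpose j k"
    using assms(4-6) by (auto simp: fun_eq_iff transpose_def)
  show "app (Zop i j * Zop j k + Zop j k * Zop k i + Zop k i * Zop i j) v (d, g, T) \<in> I"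
    using I_right[OF z_triangle[OF assms] v]
    by (simp only: plus_opr.rep_eq app_Zop_pair t) (auto simp: I_zero simp flip: distrib_right)
qed

section \<open>The shifted elements and their anticommutation\<close>

definition theta_op :: "nat set \<Rightarrow> nat \<Rightarrow> 'p opr" where
  "theta_op U i = (\<Sum>j\<in>U - {i}. Zop i j)"

definition xop :: "nat set \<Rightarrow> nat \<Rightarrow> 'p opr" where
  "xop U i = Aop i + theta_op U i"

lemma theta_op_ops: "U \<subseteq> V \<Longrightarrow> i \<in> U \<Longrightarrow> theta_op U i \<in> ops 1"
  unfolding theta_op_def by (intro ops_sum Zop_ops) auto

lemma theta_op_ops0: "U \<subseteq> V \<Longrightarrow> i \<in> U \<Longrightarrow> theta_op U i \<in> ops 0"
  using theta_op_ops ops_antimono[of 0 1] by blast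

lemma xop_ops: "U \<subseteq> V \<Longrightarrow> i \<in> U \<Longrightarrow> xop U i \<in> ops 0"
  unfolding xop_def by (intro ops_add Aop_ops theta_op_ops0)

text \<open>For each third index \<open>k\<close> the six terms on \<open>i\<close>,
  \<open>j\<close>, \<open>k\<close> form the triangle relation in both orientations. Different
  \<open>k\<close>, \<open>l\<close> give disjoint transpositions, and what remains is twice a
  square.\<close>

lemma theta_op_anticommute:
  assumes U: "U \<subseteq> V" and ij: "i \<in> U" "j \<in> U" "i \<noteq> j"
  shows "theta_op U i * theta_op U j + theta_op U j * theta_op U i \<in> negl"
proof -
  define W where "W = U - {i, j}"
  have fin: "finite W" using U finite_V finite_subset W_def by auto
  have split: "U - {i} = insert j W" "U - {j} = insert i W" "j \<notin> W" "i \<notin> W" using ij by (auto simp: W_def)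
  define Z where "Z = Zop i j"
  have ti: "theta_op U i = Z + (\<Sum>k\<in>W. Zop i k)" and tj: "theta_op U j = Z + (\<Sum>k\<in>W. Zop j k)"
    using split fin Zop_sym[of i j] by (simp_all add: theta_op_def Z_def)
  define F where "F k l = Zop i k * Zop j l + Zop j l * Zop i k" for k l
  define G where "G k = Z * Zop j k + Zop i k * Z + Z * Zop i k + Zop j k * Z" for k
  have FF: "(\<Sum>k\<in>W. Zop i k) * (\<Sum>k\<in>W. Zop j k) + (\<Sum>k\<in>W. Zop j k) * (\<Sum>k\<in>W. Zop i k)
      = (\<Sum>k\<in>W. \<Sum>l\<in>W. F k l)"
    unfolding sum_product F_def sum.distrib by (subst (2) sum.swap) simp
  have "(\<Sum>l\<in>W. F k l) = F k k + (\<Sum>l\<in>W - {k}. F k l)" if "k \<in> W" for k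
    using fin that by (simp add: sum.remove)
  with FF have "theta_op U i * theta_op U j + theta_op U j * theta_op U i =
      (Z * Z + Z * Z) + (\<Sum>k\<in>W. G k + F k k + (\<Sum>l\<in>W - {k}. F k l))"
    unfolding ti tj G_def
    by (simp add: algebra_simps sum.distrib sum_distrib_left sum_distrib_right)
  also have "\<dots> \<in> negl"
  proof -
    have zz: "Z * Z \<in> negl" unfolding Z_def using U ij by (auto intro: Zop_square)
    have k: "k \<in> V" "k \<noteq> i" "k \<noteq> j" "i \<in> V" "j \<in> V" if "k \<in> W" for k
      using that U ij by (auto simp: W_def)
    have gk: "G k + F k k \<in> negl" if "k \<in> W" for k
    proof -
    note k = k[OF that]
    have "(Zop i j * Zop j k + Zop j k * Zop k i + Zop k i * Zop i j) +
        (Zop j i * Zop i k + Zop i k * Zop k j + Zop k j * Zop j i) \<in> negl"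
      using k ij by (intro negl_add Zop_triangle) auto
    then show ?thesis
      by (simp add: G_def F_def Z_def Zop_sym[of j i] Zop_sym[of k] algebra_simps)
    qed
    have fkl: "F k l \<in> negl" if "k \<in> W" "l \<in> W - {k}" for k l
    proof -
      have "l \<in> V" "l \<noteq> i" "l \<noteq> j" "l \<noteq> k" using that U by (auto simp: W_def)
      then show ?thesis unfolding F_def using k[OF that(1)] ij by (intro Zop_disjoint) auto
    qed
    show ?thesis
      by (rule negl_add[OF negl_add[OF zz zz] negl_sum[OF negl_add[OF gk negl_sum[OF fkl]]]])
  qed
  finally show ?thesis .
qed

lemma Zop_Aop_simps:
  assumes "i \<in> V" "j \<in> V" "k \<in> V"
  shows "Zop i j * Aop i + Aop j * Zop i j \<in> negl"
    "k \<noteq> i \<Longrightarrow> k \<noteq> j \<Longrightarrow> Zop i j * Aop k + Aop k * Zop i j \<in> negl"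
  using Zop_Aop[of i j i] Zop_Aop[of i j k] assms by simp_all

text \<open>Since \<open>Zop i j\<close> exchanges the two parameters up to sign, its terms cancel
  across the two anticommutators. Every other \<open>Zop\<close> anticommutes with the parameter it
  is paired with.\<close>

lemma Aop_theta_op:
  assumes U: "U \<subseteq> V" and ij: "i \<in> U" "j \<in> U" "i \<noteq> j"
  shows "Aop i * theta_op U j + theta_op U j * Aop i + (Aop j * theta_op U i + theta_op U i * Aop j) \<in> negl"
proof -
  define W where "W = U - {i, j}"
  have fin: "finite W" using U finite_V finite_subset W_def by auto
  have split: "U - {i} = insert j W" "U - {j} = insert i W" "j \<notin> W" "i \<notin> W" using ij by (auto simp: W_def)
  define Z where "Z = Zop i j"
  have ti: "theta_op U i = Z + (\<Sum>k\<in>W. Zop i k)" and tj: "theta_op U j = Z + (\<Sum>k\<in>W. Zop j k)"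
    using split fin Zop_sym[of i j] by (simp_all add: theta_op_def Z_def)
  have "Aop i * theta_op U j + theta_op U j * Aop i + (Aop j * theta_op U i + theta_op U i * Aop j) =
      (Z * Aop i + Aop j * Z) + (Z * Aop j + Aop i * Z) +
      (\<Sum>k\<in>W. (Zop j k * Aop i + Aop i * Zop j k) + (Zop i k * Aop j + Aop j * Zop i k))"
    unfolding ti tj by (simp add: algebra_simps sum.distrib sum_distrib_left sum_distrib_right)
  also have "\<dots> \<in> negl"
  proof -
    have V: "i \<in> V" "j \<in> V" using U ij by auto
    have z: "Z * Aop i + Aop j * Z \<in> negl" "Z * Aop j + Aop i * Z \<in> negl"
      using Zop_Aop_simps(1)[of i j] Zop_Aop_simps(1)[of j i] V by (simp_all add: Z_def Zop_sym[of j i])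
    have k: "Zop j k * Aop i + Aop i * Zop j k \<in> negl" "Zop i k * Aop j + Aop j * Zop i k \<in> negl"
      if "k \<in> W" for k
    proof -
      have "k \<in> V" "k \<noteq> i" "k \<noteq> j" using U that by (auto simp: W_def)
      then show "Zop j k * Aop i + Aop i * Zop j k \<in> negl" "Zop i k * Aop j + Aop j * Zop i k \<in> negl"
        using V ij by (auto intro!: Zop_Aop_simps(2))
    qed
    show ?thesis by (rule negl_add[OF negl_add[OF z] negl_sum[OF negl_add[OF k]]])
  qed
  finally show ?thesis .
qed

lemma xop_anticommute:
  assumes U: "U \<subseteq> V" and ij: "i \<in> U" "j \<in> U" "i \<noteq> j"
  shows "xop U i * xop U j + xop U j * xop U i \<in> negl"
proof -
  have "xop U i * xop U j + xop U j * xop U i = (Aop i * Aop j + Aop j * Aop i) +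
     (Aop i * theta_op U j + theta_op U j * Aop i + (Aop j * theta_op U i + theta_op U i * Aop j)) +
     (theta_op U i * theta_op U j + theta_op U j * theta_op U i)"
    by (simp add: xop_def algebra_simps)
  then show ?thesis
    using Aop_anticommute[of i j] Aop_theta_op[OF assms] theta_op_anticommute[OF assms] U ij
    by (auto intro: negl_add)
qed

section \<open>Rigidity of operators commuting with the squares of the shifted elements\<close>

lemma app_sum_fun: "app f (\<lambda>x. \<Sum>s\<in>S. u s x) = (\<lambda>x. \<Sum>s\<in>S. app f (u s) x)"
  by (induction S rule: infinite_finite_induct) (simp_all add: app_zero app_add)

lemma app_of_nat_fun: "app f (\<lambda>x. of_nat k * v x) = (\<lambda>x. of_nat k * app f v x)"
  by (induction k) (simp_all add: app_zero distrib_right app_add)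

lemma app_Aop_square_const:
  assumes "i \<in> V" "\<And>d g T. \<not> good g \<or> g i \<noteq> a \<Longrightarrow> v (d, g, T) = 0"
  shows "app (Aop i * Aop i) v = (\<lambda>x. of_nat a * v x)"
proof
  fix x :: state
  obtain d g T where x: "x = (d, g, T)" by (cases x)
  show "app (Aop i * Aop i) v x = of_nat a * v x"
  proof (cases "good g \<and> g i = a")
    case True
    then show ?thesis using app_Aop_square[of g i v d T] assms(1) x by simp
  next
    case False
    then have "v (d, g, S) = 0" for S using assms(2) by blast
    then show ?thesis by (simp add: x times_opr.rep_eq app_Aop clif_def)
  qed
qed

text \<open>
  The squares of the parameters separate the permutations, so an operator commuting with all
  \<open>xop U j * xop U j\<close> has, in lowest degree, only diagonal components.
\<close>
lemma rigidity:
  assumes U: "U \<subseteq> V" and G: "G \<in> ops 0"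
    and comm: "\<And>j. j \<in> U \<Longrightarrow> xop U j * xop U j * G - G * (xop U j * xop U j) \<in> negl"
    and diag: "\<And>v d g T. v \<in> supp 0 \<Longrightarrow> good g \<Longrightarrow>
      (\<And>d' g' T'. \<exists>j\<in>U. g' j \<noteq> g j \<Longrightarrow> v (d', g', T') = 0) \<Longrightarrow> app G v (d, g, T) \<in> I"
  shows "G \<in> negl"
proof -
  have "G \<in> small d" for d
  proof (induction d)
    case 0
    have "app G v \<in> null (e + 0)" if "v \<in> supp e" for v e
    proof -
      have "app G v \<in> supp (e + 0)" using G that unfolding ops_def by blast
      then show ?thesis by (auto simp: supp_def null_def I_zero)
    qed
    then show ?case by (simp add: small_def)
  next
    case (Suc d)
    \<comment> \<open>Apart from the square of the parameter, all terms of
      \<open>xop U j * xop U j\<close> raise the degree, so next to \<open>G\<close> in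
      \<open>small d\<close> they only contribute to \<open>small (Suc d)\<close>.\<close>
    have sq: "Aop j * Aop j * G - G * (Aop j * Aop j) \<in> small (Suc d)" if j: "j \<in> U" for j
    proof -
      define N where "N = Aop j * theta_op U j + theta_op U j * Aop j + theta_op U j * theta_op U j"
      have t: "theta_op U j \<in> ops 1" "theta_op U j \<in> ops 0" using U j theta_op_ops theta_op_ops0 by auto
      have "N \<in> ops 1" unfolding N_def
        using ops_mult[OF Aop_ops t(1)] ops_mult[OF t(1) Aop_ops] ops_mult[OF t]
        by (intro ops_add) simp_all
      then have "N * G \<in> small (Suc d)" "G * N \<in> small (Suc d)"
        using small_left[OF Suc] small_right[OF Suc] by fastforce+
      moreover have "Aop j * Aop j * G - G * (Aop j * Aop j) =
          (xop U j * xop U j * G - G * (xop U j * xop U j)) - (N * G - G * N)"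
        by (simp add: xop_def N_def algebra_simps)
      ultimately show ?thesis using negl_small[OF comm[OF j]] by (simp add: small_diff)
    qed
    have "app G v (d', g, T) \<in> I" if v: "v \<in> supp e" and d': "d' < e + Suc d" and g: "good g" for v e d' g T
    proof -
      \<comment> \<open>\<open>r U'\<close> restricts \<open>v\<close> to the permutations agreeing
        with \<open>g\<close> on \<open>U'\<close>. Enlarging \<open>U'\<close> one index at a time
        leads from \<open>v\<close> to a vector to which \<open>diag\<close> applies.\<close>
      define r where "r U' = (\<lambda>x :: state. if \<forall>j\<in>U'. fst (snd x) j = g j then v x else 0)" for U'
      have r: "r U' \<in> supp e" for U' using v by (auto simp: r_def supp_def C_zero)
      have fin: "finite U" using U finite_V finite_subset by blast
      have "U' \<subseteq> U \<Longrightarrow> app G v (d', g, T) - app G (r U') (d', g, T) \<in> I" if "finite U'" for U'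
        using that
      proof (induction U')
        case empty
        have "r {} = v" by (simp add: r_def)
        then show ?case by (simp add: I_zero)
      next
        case (insert j U')
        \<comment> \<open>Split by the value of the permutation at \<open>j\<close>; the summand
          with value \<open>g j\<close> is the next restriction.\<close>
        define u where "u a = (\<lambda>x :: state. if fst (snd x) j = a then r U' x else 0)" for a
        have j: "j \<in> U" "j \<in> V" using insert U by auto
        have u: "u a \<in> supp e" for a using r[of U'] by (auto simp: u_def supp_def C_zero)
        have nongood: "r U' (d, g', T) = 0" if "\<not> good g'" for d g' T
          using r[of U'] that by (auto simp: supp_def)
        have "r U' = (\<lambda>x. \<Sum>a\<in>V. u a x)"
        proof
          fix x :: state
          obtain d g' T where x: "x = (d, g', T)" by (cases x)
          show "r U' x = (\<Sum>a\<in>V. u a x)"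
          proof (cases "good g'")
            case True
            then have "g' j \<in> V" using j(2) good_range by blast
            then show ?thesis using finite_V by (simp add: x u_def)
          next
            case False
            then have "r U' x = 0" using nongood x by simp
            then have "\<forall>a\<in>V. u a x = 0" unfolding u_def by metis
            then have "(\<Sum>a\<in>V. u a x) = 0" by (rule sum.neutral)
            then show ?thesis unfolding \<open>r U' x = 0\<close> by (rule sym)
          qed
        qed
        then have "app G (r U') (d', g, T) = (\<Sum>a\<in>V. app G (u a) (d', g, T))" by (simp only: app_sum_fun)
        also have "\<dots> = app G (u (g j)) (d', g, T) + (\<Sum>a\<in>V - {g j}. app G (u a) (d', g, T))"
          using finite_V good_range[OF g j(2)] by (simp add: sum.remove)
        finally have eq: "app G (r U') (d', g, T) = \<dots>" .
        have "u (g j) = r (insert j U')" by (auto simp: u_def r_def fun_eq_iff)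
        moreover have "(\<Sum>a\<in>V - {g j}. app G (u a) (d', g, T)) \<in> I"
        proof (rule I_sum)
          fix a assume a: "a \<in> V - {g j}"
          \<comment> \<open>The square acts on \<open>u a\<close> as the scalar \<open>a\<close>,
            but as \<open>g j\<close> on the output at \<open>g\<close>. The commutator thus scales
            this component by the nonzero integer \<open>g j - a\<close>, which
            \<open>I_torsion\<close> cancels.\<close>
          have "app (Aop j * Aop j) (u a) = (\<lambda>x. of_nat a * u a x)"
            using j(2) nongood by (intro app_Aop_square_const) (auto simp: u_def)
          then have "app (Aop j * Aop j * G - G * (Aop j * Aop j)) (u a) (d', g, T) =
              of_nat (g j) * app G (u a) (d', g, T) - of_nat a * app G (u a) (d', g, T)"
            using app_Aop_square[OF g j(2), of "app G (u a)" d' T]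
            by (simp add: minus_opr.rep_eq times_opr.rep_eq app_of_nat_fun)
          moreover have "app (Aop j * Aop j * G - G * (Aop j * Aop j)) (u a) (d', g, T) \<in> I"
            using sq[OF j(1)] u[of a] d' g unfolding small_def null_def by blast
          ultimately have *: "of_int (int (g j) - int a) * app G (u a) (d', g, T) \<in> I"
            by (simp add: left_diff_distrib)
          show "app G (u a) (d', g, T) \<in> I"
            by (rule I_torsion[OF _ *]) (use a in auto)
        qed
        ultimately have "app G (r U') (d', g, T) - app G (r (insert j U')) (d', g, T) \<in> I"
          unfolding eq by simp
        moreover have "app G v (d', g, T) - app G (r U') (d', g, T) \<in> I" using insert by simp
        ultimately show ?case by (auto dest: I_add)
      qed
      from this[OF fin] have "app G v (d', g, T) - app G (r U) (d', g, T) \<in> I" by simp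
      moreover have "app G (r U) (d', g, T) \<in> I"
        using r[of U] supp_antimono[of 0 e] g by (intro diag) (auto simp: r_def)
      ultimately show ?thesis by (auto dest: I_add)
    qed
    then show ?case by (auto simp: small_def null_def)
  qed
  then show ?thesis by (simp add: negl_def)
qed

section \<open>Expansion into words\<close>

text \<open>The diagonal letter \<open>(i, i)\<close> encodes the parameter, so that
  \<open>xop U i\<close> becomes one sum over all partners in \<open>U\<close>; in
  \<open>word_perm\<close> such a letter is trivial.\<close>

definition hop :: "nat \<times> nat \<Rightarrow> 'p opr" where
  "hop t = (if fst t = snd t then Aop (fst t) else Zop (fst t) (snd t))"

definition opword :: "(nat \<times> nat) list \<Rightarrow> 'p opr" where
  "opword ts = prod_list (map hop ts)"

definition zlist :: "(nat \<times> nat) list \<Rightarrow> 'p" where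
  "zlist ts = prod_list (map (\<lambda>t. z (fst t) (snd t)) ts)"

abbreviation proper :: "(nat \<times> nat) list \<Rightarrow> (nat \<times> nat) list" where
  "proper \<equiv> filter (\<lambda>t. fst t \<noteq> snd t)"

abbreviation words :: "nat set \<Rightarrow> nat \<Rightarrow> nat list set" where
  "words U k \<equiv> {as. set as \<subseteq> U \<and> length as = k}"

lemma hop_ops: "fst t \<in> V \<Longrightarrow> snd t \<in> V \<Longrightarrow> hop t \<in> ops 0"
  by (simp add: hop_def Aop_ops Zop_ops0)

lemma opword_ops: "fst ` set ts \<union> snd ` set ts \<subseteq> V \<Longrightarrow> opword ts \<in> ops 0"
  unfolding opword_def by (rule ops_prod_list) (auto intro: hop_ops)

lemma xop_hop:
  assumes "U \<subseteq> V" "i \<in> U" shows "xop U i = (\<Sum>a\<in>U. hop (i, a))"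
proof -
  have "finite U" using assms(1) finite_V finite_subset by blast
  then have "(\<Sum>a\<in>U. hop (i, a)) = hop (i, i) + (\<Sum>a\<in>U - {i}. hop (i, a))"
    using assms(2) by (rule sum.remove)
  also have "(\<Sum>a\<in>U - {i}. hop (i, a)) = theta_op U i"
    unfolding theta_op_def by (rule sum.cong) (auto simp: hop_def)
  finally show ?thesis by (simp add: xop_def hop_def)
qed

lemma words_Suc: "words U (Suc k) = (\<lambda>(a, as). a # as) ` (U \<times> words U k)"
  by (auto simp: length_Suc_conv image_iff)

lemma prod_list_xop:
  assumes "U \<subseteq> V" "set xs \<subseteq> U"
  shows "prod_list (map (xop U) xs) = (\<Sum>as\<in>words U (length xs). opword (zip xs as))"
  using assms(2)
proof (induction xs)
  case Nil
  have "words U 0 = {[]}" by auto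
  then show ?case by (simp add: opword_def)
next
  case (Cons i xs)
  have "(\<Sum>as\<in>words U (Suc (length xs)). opword (zip (i # xs) as)) =
      (\<Sum>(a, as)\<in>U \<times> words U (length xs). hop (i, a) * opword (zip xs as))"
    unfolding words_Suc
    by (subst sum.reindex) (auto simp: inj_on_def opword_def intro!: sum.cong)
  also have "\<dots> = xop U i * prod_list (map (xop U) xs)"
    using Cons assms(1) by (simp add: xop_hop sum_product sum.cartesian_product)
  finally show ?case by simp
qed

text \<open>The proper letters put their \<open>z\<close> factors on the left in order, and the
  whole word reads \<open>v\<close> at the single permutation \<open>g \<circ> word_perm ts\<close>;
  the Clifford part is absorbed into \<open>f\<close>.\<close>

lemma app_opword:
  assumes "\<And>x. v x \<in> C"
  shows "\<exists>f. (\<forall>T. f T \<in> C) \<and> (\<forall>T. app (opword ts) v (d, g, T) = zlist (proper ts) * f T) \<and>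
    ((\<forall>d' T. v (d', g \<circ> word_perm ts, T) = 0) \<longrightarrow> (\<forall>T. f T = 0))"
proof (induction ts arbitrary: d g)
  case Nil
  then show ?case
    using assms by (intro exI[of _ "\<lambda>T. v (d, g, T)"]) (simp add: opword_def zlist_def one_opr.rep_eq)
next
  case (Cons t ts)
  obtain i a where t: "t = (i, a)" by (cases t)
  have opw: "app (opword (t # ts)) v = app (hop t) (app (opword ts) v)"
    by (simp add: opword_def times_opr.rep_eq)
  show ?case
  proof (cases "a = i")
    case True
    from Cons[of d g] obtain f where f: "\<And>T. f T \<in> C"
      "\<And>T. app (opword ts) v (d, g, T) = zlist (proper ts) * f T"
      "(\<forall>d' T. v (d', g \<circ> word_perm ts, T) = 0) \<longrightarrow> (\<forall>T. f T = 0)" by blast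
    have "cl b (\<lambda>S. zlist (proper ts) * f S) T = zlist (proper ts) * cl b f T" for b T
      unfolding clif_def
      by (simp only: mult_of_int_commute[of _ "zlist (proper ts)", symmetric] mult.assoc[symmetric])
    then have "app (opword (t # ts)) v (d, g, T) = zlist (proper (t # ts)) * (cl (g i) f T + cl w f T)" for T
      using f(2) by (simp add: t True opw[unfolded t True] hop_def app_Aop distrib_left)
    moreover have perm: "word_perm (t # ts) = word_perm ts" by (simp add: t True)
    moreover have "cl (g i) f T + cl w f T = 0" if "\<forall>d' T. v (d', g \<circ> word_perm ts, T) = 0" for T
    proof -
      have "f S = 0" for S using f(3) that by blast
      then show ?thesis by (simp add: clif_zero)
    qed
    moreover have "cl (g i) f T + cl w f T \<in> C" for T using f(1) by (simp add: clif_C C_add)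
    ultimately show ?thesis
      unfolding perm by (intro exI[of _ "\<lambda>T. cl (g i) f T + cl w f T"] conjI allI impI) blast+
  next
    case False
    then have pr: "zlist (proper (t # ts)) = z i a * zlist (proper ts)" by (simp add: t zlist_def)
    show ?thesis
    proof (cases d)
      case 0
      then show ?thesis using False by (intro exI[of _ "\<lambda>_. 0"]) (simp add: t opw[unfolded t] hop_def C_zero)
    next
      case (Suc e)
      from Cons[of e "g \<circ> transpose i a"] obtain f where f: "\<And>T. f T \<in> C"
        "\<And>T. app (opword ts) v (e, g \<circ> transpose i a, T) = zlist (proper ts) * f T"
        "(\<forall>d' T. v (d', g \<circ> transpose i a \<circ> word_perm ts, T) = 0) \<longrightarrow> (\<forall>T. f T = 0)" by blast
      moreover have "app (opword (t # ts)) v (d, g, T) = zlist (proper (t # ts)) * f (sym_diff T {0})" for T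
        unfolding pr using f(2) False Suc by (simp add: t opw[unfolded t] hop_def mult.assoc)
      moreover have perm: "g \<circ> word_perm (t # ts) = g \<circ> transpose i a \<circ> word_perm ts"
        by (simp add: t comp_assoc)
      ultimately show ?thesis using f(1) unfolding perm
        by (intro exI[of _ "\<lambda>T. f (sym_diff T {0})"] conjI allI impI) blast+
    qed
  qed
qed

text \<open>Supplies the last hypothesis of \<open>rigidity\<close> word by word: a nontrivial
  product moves some index of \<open>U\<close>, so the word reads \<open>v\<close> where it
  vanishes.\<close>

lemma opword_diagonal:
  assumes U: "U \<subseteq> V" and ts: "fst ` set ts \<union> snd ` set ts \<subseteq> U"
    and v: "v \<in> supp 0" and g: "good g"
    and vanish: "\<And>d' g' T'. \<exists>j\<in>U. g' j \<noteq> g j \<Longrightarrow> v (d', g', T') = 0"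
    and trivial: "word_perm ts = id \<Longrightarrow> zlist (proper ts) \<in> I"
  shows "app (opword ts) v (d, g, T) \<in> I"
proof -
  have "v x \<in> C" for x using v by (cases x) (auto simp: supp_def)
  from app_opword[where v = v and ts = ts and d = d and g = g, OF this] obtain f where f: "\<And>T. f T \<in> C"
    "\<And>T. app (opword ts) v (d, g, T) = zlist (proper ts) * f T"
    "(\<forall>d' T. v (d', g \<circ> word_perm ts, T) = 0) \<longrightarrow> (\<forall>T. f T = 0)" by blast
  show ?thesis
  proof (cases "word_perm ts = id")
    case True
    then show ?thesis using f trivial I_right by simp
  next
    case False
    then obtain j where j: "word_perm ts j \<noteq> j" by (auto simp: fun_eq_iff)
    have "j \<in> U" using j word_perm_outside[of ts U j] ts by (auto simp: image_subset_iff)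
    moreover have "(g \<circ> word_perm ts) j \<noteq> g j" using j good_inj[OF g] by simp
    ultimately have "f T = 0" using vanish f(3) by blast
    then show ?thesis using f(2) I_zero by simp
  qed
qed

section \<open>Words of generators lying in the ideal\<close>

lemma zlist_append: "zlist (us @ vs) = zlist us * zlist vs"
  by (simp add: zlist_def)

lemma zlist_C: "\<lbrakk>\<forall>t\<in>set ts. fst t \<in> V \<and> snd t \<in> V \<and> fst t \<noteq> snd t\<rbrakk> \<Longrightarrow> zlist ts \<in> C"
  by (induction ts) (auto simp: zlist_def C_one z_C C_mult)

lemma zlist_adjacent:
  assumes "\<forall>t\<in>set (us @ t # t # vs). fst t \<in> V \<and> snd t \<in> V \<and> fst t \<noteq> snd t"
  shows "zlist (us @ t # t # vs) \<in> I"
proof -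
  have "zlist (us @ t # t # vs) = zlist us * (z (fst t) (snd t) * z (fst t) (snd t) * zlist vs)"
    by (simp add: zlist_append) (simp add: zlist_def mult.assoc)
  moreover have "zlist us \<in> C" "zlist vs \<in> C" using assms by (auto intro: zlist_C)
  moreover have "z (fst t) (snd t) * z (fst t) (snd t) \<in> I" using assms by (auto intro: z_square)
  ultimately show ?thesis by (simp add: I_left I_right)
qed

lemma zlist_anticommute:
  assumes "\<forall>t\<in>set ms. fst t \<in> V \<and> snd t \<in> V \<and> fst t \<noteq> snd t \<and> \<not> touches i t \<and> \<not> touches j t"
    and "i \<in> V" "j \<in> V" "i \<noteq> j"
  shows "zlist ms * z i j - (- 1) ^ length ms * z i j * zlist ms \<in> I"
  using assms(1)
proof (induction ms)
  case Nil
  then show ?case by (simp add: zlist_def I_zero)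
next
  case (Cons t ms)
  define y s where "y = z (fst t) (snd t)" and "s = ((- 1) ^ length ms :: 'p)"
  have s: "s * p = p * s" "s \<in> C" for p
    using C_of_int[of "(- 1) ^ length ms"] by (cases "even (length ms)"; simp add: s_def)+
  have C: "zlist ms \<in> C" using Cons.prems by (intro zlist_C) auto
  have y: "y \<in> C" "y * z i j + z i j * y \<in> I"
    unfolding y_def using Cons.prems assms by (auto intro!: z_C z_disjoint simp: touches_def)
  have "y * (zlist ms * z i j - s * z i j * zlist ms) + s * ((y * z i j + z i j * y) * zlist ms) \<in> I"
    using Cons by (intro I_add[OF I_left[OF y(1)] I_left[OF s(2) I_right[OF y(2) C]]]) (simp add: s_def)
  also have "y * (zlist ms * z i j - s * z i j * zlist ms) + s * ((y * z i j + z i j * y) * zlist ms) =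
      (y * zlist ms) * z i j + s * z i j * (y * zlist ms)"
    by (simp add: algebra_simps s(1))
  finally show ?case by (simp add: y_def s_def zlist_def mult.assoc)
qed

text \<open>By \<open>distinct_centres_cancel\<close> the last letter has a reversed copy and only
  disjoint letters in between. Moving it left through these costs a sign and creates a
  square.\<close>

lemma zlist_distinct_centres:
  assumes "distinct (map fst ts)" "word_perm ts = id" "ts \<noteq> []"
    and V: "\<forall>t\<in>set ts. fst t \<in> V \<and> snd t \<in> V \<and> fst t \<noteq> snd t"
  shows "zlist ts \<in> I"
proof -
  have "\<forall>t\<in>set ts. fst t \<noteq> snd t" using V by blast
  obtain us ms i j where ts: "ts = us @ (j, i) # ms @ [(i, j)]"
    and ms: "\<forall>t\<in>set ms. \<not> touches i t \<and> \<not> touches j t"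
    by (rule distinct_centres_cancel[OF assms(1) \<open>\<forall>t\<in>set ts. fst t \<noteq> snd t\<close> assms(2,3)])
  have ij: "i \<in> V" "j \<in> V" "i \<noteq> j" using V ts by auto
  define s where "s = ((- 1) ^ length ms :: 'p)"
  have s: "s * p = p * s" "s \<in> C" for p
    using C_of_int[of "(- 1) ^ length ms"] by (cases "even (length ms)"; simp add: s_def)+
  have C: "zlist us \<in> C" "zlist ms \<in> C" "z j i \<in> C" using V ts ij by (auto intro!: zlist_C z_C)
  have m: "zlist ms * z i j - s * z i j * zlist ms \<in> I"
    unfolding s_def by (rule zlist_anticommute) (use V ms ij in \<open>auto simp: ts\<close>)
  have "z i j * z i j \<in> I" using ij by (rule z_square)
  from I_left[OF C(1) I_add[OF I_left[OF C(3) m] I_left[OF s(2) I_right[OF this C(2)]]]]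
  have "zlist us * (z j i * (zlist ms * z i j - s * z i j * zlist ms) + s * (z i j * z i j * zlist ms)) \<in> I" .
  moreover have "z j i * (s * z i j * zlist ms) = s * (z i j * z i j * zlist ms)"
    unfolding z_sym[of j i] by (simp only: mult.assoc[symmetric] s(1)[symmetric, of "z i j"])
  moreover have "zlist ts = zlist us * (z j i * (zlist ms * z i j))"
    unfolding ts by (simp add: zlist_append) (simp add: zlist_def)
  ultimately show ?thesis by (simp add: right_diff_distrib)
qed

text \<open>The integer \<open>c\<close> records signs. Allowing \<open>h'\<close> to differ from
  \<open>h\<close> covers \<open>Zop i j\<close>, which permutes the parameters as they
  pass.\<close>

definition intertwines :: "int \<Rightarrow> 'p opr \<Rightarrow> 'p opr \<Rightarrow> 'p opr \<Rightarrow> bool" where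
  "intertwines c f h h' \<longleftrightarrow> f * h - of_int c * (h' * f) \<in> negl"

abbreviation comm_up :: "int \<Rightarrow> 'p opr \<Rightarrow> 'p opr \<Rightarrow> bool" where
  "comm_up c f h \<equiv> intertwines c f h h"

lemma comm_up_sum: "(\<And>s. s \<in> S \<Longrightarrow> comm_up c (F s) h) \<Longrightarrow> comm_up c (sum F S) h"
  using negl_sum[of S "\<lambda>s. F s * h - of_int c * (h * F s)"]
  by (simp add: intertwines_def sum_distrib_left sum_distrib_right sum_subtractf)

lemma comm_up_add: "comm_up c f h \<Longrightarrow> comm_up c g h \<Longrightarrow> comm_up c (f + g) h"
  using negl_add[of "f * h - of_int c * (h * f)" "g * h - of_int c * (h * g)"]
  by (simp add: intertwines_def algebra_simps)

lemma comm_up_diff_right: "comm_up c f h \<Longrightarrow> comm_up c f g \<Longrightarrow> comm_up c f (h - g)"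
  using negl_diff[of "f * h - of_int c * (h * f)" "f * g - of_int c * (g * f)"]
  by (simp add: intertwines_def algebra_simps)

lemma comm_up_mult:
  assumes "comm_up c f h" "comm_up c' g h" "f \<in> ops 0" "g \<in> ops 0"
  shows "comm_up (c * c') (f * g) h"
proof -
  have "f * (g * h - of_int c' * (h * g)) + of_int c' * ((f * h - of_int c * (h * f)) * g) \<in> negl"
    using assms ops_of_int by (intro negl_add negl_left negl_right) (auto simp: intertwines_def)
  moreover have "f * (of_int c' * (h * g)) = of_int c' * (f * (h * g))"
    "of_int c' * (of_int c * (h * (f * g))) = of_int (c * c') * (h * (f * g))"
    by (simp_all only: mult_of_int_commute[of c' f, symmetric] of_int_mult mult.assoc[symmetric]
        mult_of_int_commute[of c' "of_int c", symmetric])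
  ultimately show ?thesis
    by (simp add: intertwines_def right_diff_distrib left_diff_distrib mult.assoc del: of_int_mult)
qed

lemma intertwines_mult:
  assumes "intertwines c f h h'" "intertwines c' f g g'" "h' \<in> ops 0" "g \<in> ops 0"
  shows "intertwines (c * c') f (h * g) (h' * g')"
proof -
  have "(f * h - of_int c * (h' * f)) * g + of_int c * (h' * (f * g - of_int c' * (g' * f))) \<in> negl"
    using assms ops_of_int by (intro negl_add negl_left negl_right) (auto simp: intertwines_def)
  moreover have "h' * (of_int c' * (g' * f)) = of_int c' * (h' * (g' * f))"
    by (simp only: mult_of_int_commute[of c' h', symmetric] mult.assoc[symmetric])
  moreover have "of_int c * (h' * (of_int c' * (g' * f))) = of_int (c * c') * (h' * (g' * f))"
    unfolding calculation(2) by (simp only: of_int_mult mult.assoc)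
  ultimately show ?thesis
    by (simp add: intertwines_def right_diff_distrib left_diff_distrib mult.assoc del: of_int_mult)
qed

lemma intertwines_prod_list:
  assumes "\<And>k. k \<in> set ks \<Longrightarrow> intertwines c f (F k) (F' k) \<and> F k \<in> ops 0 \<and> F' k \<in> ops 0"
  shows "intertwines (c ^ length ks) f (prod_list (map F ks)) (prod_list (map F' ks))"
  using assms
proof (induction ks)
  case Nil
  then show ?case by (simp add: intertwines_def negl_zero)
next
  case (Cons k ks)
  then show ?case by (auto intro!: intertwines_mult ops_prod_list)
qed

section \<open>Products of the shifted elements\<close>

lemma comm_up_minus: "f * h + h * f \<in> negl \<Longrightarrow> comm_up (- 1) f h"
  by (simp add: intertwines_def)

lemma comm_up_square: "comm_up ((- 1) ^ m) f h \<Longrightarrow> f \<in> ops 0 \<Longrightarrow> comm_up 1 (f * f) h"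
  using comm_up_mult[of "(- 1) ^ m" f h "(- 1) ^ m" f] by (simp flip: power_add mult_2)

lemma xop_square_xop:
  assumes "U \<subseteq> V" "i \<in> U" "j \<in> U" shows "comm_up 1 (xop U j * xop U j) (xop U i)"
proof (cases "i = j")
  case True
  then show ?thesis by (simp add: intertwines_def mult.assoc negl_zero)
next
  case False
  then have "comm_up (- 1) (xop U j) (xop U i)" using assms by (intro comm_up_minus xop_anticommute) auto
  then show ?thesis using comm_up_square[of 1] xop_ops[OF assms(1,3)] by simp
qed

lemma Aop_comm_up: "i \<in> V \<Longrightarrow> j \<in> V \<Longrightarrow> i \<noteq> j \<Longrightarrow> comm_up (- 1) (Aop i) (Aop j)"
  by (intro comm_up_minus Aop_anticommute)

lemma Aop_prod_list_ops: "prod_list (map Aop xs) \<in> ops 0"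
  by (rule ops_prod_list) (auto intro: Aop_ops)

lemma Aop_prod_list:
  assumes "i \<in> V" "i \<notin> set xs" "set xs \<subseteq> V"
  shows "comm_up ((- 1) ^ length xs) (Aop i) (prod_list (map Aop xs))"
  using assms by (intro intertwines_prod_list) (auto intro!: Aop_comm_up Aop_ops)

text \<open>\<open>Aop i\<close> commutes with its own factor and gains a sign from each of the
  other \<open>length xs - 1\<close>; the exponent has the same parity and avoids
  subtraction.\<close>

lemma Aop_prod_list_mem:
  assumes "distinct xs" "set xs \<subseteq> V" "i \<in> set xs"
  shows "comm_up ((- 1) ^ (length xs + 1)) (Aop i) (prod_list (map Aop xs))"
proof -
  obtain us vs where xs: "xs = us @ i # vs" using assms(3) by (metis split_list)
  have "comm_up ((- 1) ^ length us * (1 * (- 1) ^ length vs)) (Aop i)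
      (prod_list (map Aop us) * (Aop i * prod_list (map Aop vs)))"
    using assms xs
    by (intro intertwines_mult ops_mult0 Aop_prod_list_ops Aop_ops Aop_prod_list)
       (auto simp: intertwines_def negl_zero)
  then show ?thesis by (simp add: xs power_add)
qed

text \<open>Moving the left one of the exchanged factors past the middle part \<open>M\<close> costs
  the same sign \<open>c\<close> in both products and leaves an anticommutator of two
  parameters.\<close>

lemma Aop_prod_list_swap:
  assumes "distinct xs" "set xs \<subseteq> V" "i \<in> set xs" "j \<in> set xs" "i \<noteq> j"
  shows "prod_list (map Aop (map (transpose i j) xs)) + prod_list (map Aop xs) \<in> negl"
proof -
  have main: "prod_list (map Aop (map (transpose i j) xs)) + prod_list (map Aop xs) \<in> negl"
    if xs: "xs = us @ i # ms @ j # vs" for us ms vs i j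
  proof -
    have V: "i \<in> V" "j \<in> V" "i \<noteq> j" "i \<notin> set ms" "j \<notin> set ms" "set ms \<subseteq> V"
      using assms(1,2) by (auto simp: xs)
    have id: "map (transpose i j) ys = ys" if "i \<notin> set ys" "j \<notin> set ys" for ys
      using that by (intro map_idI) (auto simp: transpose_def)
    have tr: "map (transpose i j) xs = us @ j # ms @ i # vs"
      using assms(1) id[of us] id[of ms] id[of vs] unfolding xs by simp
    define M c where "M = prod_list (map Aop ms)" and "c = ((- 1) ^ length ms :: int)"
    have M: "M \<in> ops 0" unfolding M_def by (rule Aop_prod_list_ops)
    have "Aop j * M - of_int c * (M * Aop j) \<in> negl" "Aop i * M - of_int c * (M * Aop i) \<in> negl"
      using Aop_prod_list[OF V(2,5,6)] Aop_prod_list[OF V(1,4,6)]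
      by (simp_all only: intertwines_def M_def c_def)
    then have "(Aop j * M - of_int c * (M * Aop j)) * Aop i + (Aop i * M - of_int c * (M * Aop i)) * Aop j
        + of_int c * (M * (Aop i * Aop j + Aop j * Aop i)) \<in> negl"
      using V by (intro negl_add negl_right negl_left M Aop_ops ops_of_int Aop_anticommute)
    then have "Aop j * M * Aop i + Aop i * M * Aop j \<in> negl"
      by (simp add: left_diff_distrib distrib_left mult.assoc)
    then have "prod_list (map Aop us) * ((Aop j * M * Aop i + Aop i * M * Aop j) * prod_list (map Aop vs)) \<in> negl"
      by (intro negl_left negl_right Aop_prod_list_ops)
    moreover have "prod_list (map Aop (map (transpose i j) xs)) =
        prod_list (map Aop us) * (Aop j * M * Aop i * prod_list (map Aop vs))"
      "prod_list (map Aop xs) = prod_list (map Aop us) * (Aop i * M * Aop j * prod_list (map Aop vs))"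
      unfolding tr unfolding xs by (simp_all add: M_def mult.assoc)
    ultimately show ?thesis by (simp only: distrib_left distrib_right)
  qed
  obtain us vs where xs: "xs = us @ i # vs" using assms(3) by (metis split_list)
  show ?thesis
  proof (cases "j \<in> set us")
    case True
    then obtain us1 us2 where "us = us1 @ j # us2" by (metis split_list)
    then have "xs = us1 @ j # us2 @ i # vs" by (simp add: xs)
    from main[OF this] show ?thesis by (simp only: transpose_commute[of j i])
  next
    case False
    then have "j \<in> set vs" using assms(4,5) xs by auto
    then obtain vs1 vs2 where "vs = vs1 @ j # vs2" by (metis split_list)
    then have "xs = us @ i # vs1 @ j # vs2" by (simp add: xs)
    from main[OF this] show ?thesis .
  qed
qed

text \<open>Passing all factors gives \<open>(- 1) ^ length xs\<close> and exchanges the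
  \<open>i\<close>-th and \<open>j\<close>-th parameters; undoing this exchange costs one more
  sign.\<close>

lemma Zop_prod_list_mem:
  assumes "distinct xs" "set xs \<subseteq> V" "i \<in> set xs" "j \<in> set xs" "i \<noteq> j"
  shows "comm_up ((- 1) ^ (length xs + 1)) (Zop i j) (prod_list (map Aop xs))"
proof -
  have ij: "i \<in> V" "j \<in> V" using assms by auto
  define P P' c where "P = prod_list (map Aop xs)"
    and "P' = prod_list (map Aop (map (transpose i j) xs))" and "c = ((- 1) ^ length xs :: int)"
  have "intertwines (- 1) (Zop i j) (Aop k) (Aop (transpose i j k))" if "k \<in> set xs" for k
    using Zop_Aop[OF ij, of k] that assms(2) by (auto simp: intertwines_def)
  then have "intertwines c (Zop i j) P (prod_list (map (Aop \<circ> transpose i j) xs))"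
    unfolding P_def c_def o_def by (intro intertwines_prod_list) (auto intro: Aop_ops)
  then have "Zop i j * P - of_int c * (P' * Zop i j) \<in> negl"
    by (simp add: intertwines_def P'_def)
  moreover have "of_int c * ((P' + P) * Zop i j) \<in> negl"
    unfolding P_def P'_def
    by (intro negl_left negl_right Aop_prod_list_swap ops_of_int Zop_ops0 assms ij)
  ultimately have "Zop i j * P - of_int c * (P' * Zop i j) + of_int c * ((P' + P) * Zop i j) \<in> negl"
    by (rule negl_add)
  then have "Zop i j * P + of_int c * (P * Zop i j) \<in> negl"
    by (simp add: distrib_left distrib_right)
  then show ?thesis by (simp add: intertwines_def P_def c_def)
qed

lemma xop_prod_list_Aop:
  assumes "distinct xs" "set xs \<subseteq> V" "j \<in> set xs"
  shows "comm_up ((- 1) ^ (length xs + 1)) (xop (set xs) j) (prod_list (map Aop xs))"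
  unfolding xop_def theta_op_def using assms
  by (intro comm_up_add comm_up_sum Aop_prod_list_mem Zop_prod_list_mem) auto

text \<open>Apply \<open>rigidity\<close> to the difference. In its expansion each index of
  \<open>xs\<close> is the centre of one letter, so the words with trivial product vanish by
  \<open>zlist_distinct_centres\<close>.\<close>

theorem prod_list_xop_eqv:
  assumes "distinct xs" "set xs \<subseteq> V"
  shows "prod_list (map (xop (set xs)) xs) \<approx> prod_list (map Aop xs)"
proof -
  define U where "U = set xs"
  define F F0 where "F = prod_list (map (xop U) xs)" and "F0 = prod_list (map Aop xs)"
  define W where "W = words U (length xs)"
  have U: "U \<subseteq> V" "finite U" using assms(2) by (auto simp: U_def)
  have W: "finite W" "xs \<in> W" using finite_lists_length_eq[OF U(2)] by (auto simp: W_def U_def)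
  \<comment> \<open>Choosing every partner equal to its centre gives the one word without
    transpositions.\<close>
  have "opword (zip xs xs) = F0"
    by (simp add: opword_def F0_def zip_same_conv_map hop_def o_def)
  moreover have "F = (\<Sum>as\<in>W. opword (zip xs as))"
    unfolding F_def W_def by (rule prod_list_xop[OF U(1)]) (simp add: U_def)
  ultimately have diff: "F - F0 = (\<Sum>as\<in>W - {xs}. opword (zip xs as))"
    using sum.remove[OF W, of "\<lambda>as. opword (zip xs as)"] by (simp only: add_diff_cancel_left')
  have ops: "F \<in> ops 0" "F0 \<in> ops 0"
    unfolding F_def F0_def using U(1)
    by (intro ops_prod_list; auto simp: U_def intro!: Aop_ops xop_ops)+
  have "F - F0 \<in> negl"
  proof (rule rigidity[OF U(1)])
    show "F - F0 \<in> ops 0" by (rule ops_diff[OF ops])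
  next
    fix j assume j: "j \<in> U"
    have "comm_up (1 ^ length xs) (xop U j * xop U j) F"
      unfolding F_def using U(1) j by (intro intertwines_prod_list) (auto simp: U_def intro!: xop_square_xop xop_ops)
    \<comment> \<open>\<open>xop U j\<close> commutes with \<open>F0\<close> up to a sign, which
      disappears on squaring.\<close>
    moreover have "comm_up 1 (xop U j * xop U j) F0"
      unfolding F0_def U_def
      by (rule comm_up_square[OF xop_prod_list_Aop[OF assms]])
        (use j U in \<open>auto simp: U_def intro!: xop_ops\<close>)
    ultimately have "comm_up 1 (xop U j * xop U j) (F - F0)"
      by (intro comm_up_diff_right) simp_all
    then show "xop U j * xop U j * (F - F0) - (F - F0) * (xop U j * xop U j) \<in> negl"
      by (simp add: intertwines_def)
  next
    fix v d g T assume v: "v \<in> supp 0" "good g"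
      and vanish: "\<And>d' g' T'. \<exists>j\<in>U. g' j \<noteq> g j \<Longrightarrow> v (d', g', T') = 0"
    show "app (F - F0) v (d, g, T) \<in> I"
      unfolding diff app_sum
    proof (rule I_sum)
      fix as assume as: "as \<in> W - {xs}"
      define ts where "ts = zip xs as"
      have len: "length as = length xs" and asU: "set as \<subseteq> U" using as by (auto simp: W_def)
      have ts: "fst ` set ts \<union> snd ` set ts \<subseteq> U"
        using asU by (auto simp: ts_def U_def dest: set_zip_leftD set_zip_rightD)
      have fst: "map fst ts = xs" by (simp add: ts_def len)
      show "app (opword (zip xs as)) v (d, g, T) \<in> I"
        unfolding ts_def[symmetric]
      proof (rule opword_diagonal[OF U(1) ts v vanish])
        assume id: "word_perm ts = id"
        show "zlist (proper ts) \<in> I"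
        proof (rule zlist_distinct_centres)
          show "distinct (map fst (proper ts))"
            by (rule distinct_map_filter) (simp only: fst assms(1))
          show "word_perm (proper ts) = id" by (simp add: word_perm_filter_proper id)
          show "proper ts \<noteq> []"
          proof
            assume "proper ts = []"
            then have "\<forall>t\<in>set ts. fst t = snd t" by (simp add: filter_empty_conv)
            then have "map fst ts = map snd ts" by simp
            then show False using as len by (simp add: ts_def)
          qed
          show "\<forall>t\<in>set (proper ts). fst t \<in> V \<and> snd t \<in> V \<and> fst t \<noteq> snd t"
            using ts U(1) by fastforce
        qed
      qed
    qed
  qed
  then show ?thesis by (simp add: eqv_def F_def F0_def U_def)
qed

end

section \<open>Newton's identities\<close>

primrec elsym :: "'a::ring_1 list \<Rightarrow> nat \<Rightarrow> 'a" where
  "elsym [] j = (if j = 0 then 1 else 0)"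
| "elsym (b # bs) j = elsym bs j + (case j of 0 \<Rightarrow> 0 | Suc i \<Rightarrow> b * elsym bs i)"

definition psum :: "'a::ring_1 list \<Rightarrow> nat \<Rightarrow> 'a" where
  "psum bs r = (\<Sum>b\<leftarrow>bs. b ^ r)"

lemma elsym_0 [simp]: "elsym bs 0 = 1"
  by (induction bs) auto

lemma elsym_beyond: "length bs < j \<Longrightarrow> elsym bs j = 0"
  by (induction bs arbitrary: j) (auto split: nat.splits)

lemma elsym_length: "elsym bs (length bs) = prod_list bs"
  by (induction bs) (auto simp: elsym_beyond)

text \<open>In generating functions, the factor \<open>1 + b t\<close> contributed by
  \<open>b\<close> cancels against a geometric series. As \<open>b\<close> stands leftmost, this
  holds without commutativity.\<close>

lemma elsym_telescope:
  "(\<Sum>r\<le>j. (- 1) ^ r * b ^ Suc r * elsym (b # bs) (j - r)) = b * elsym bs j"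
proof (induction j)
  case (Suc j)
  have "(\<Sum>r\<le>Suc j. (- 1) ^ r * b ^ Suc r * elsym (b # bs) (Suc j - r)) =
      b * elsym (b # bs) (Suc j) + (\<Sum>r\<le>j. - (b * ((- 1) ^ r * b ^ Suc r * elsym (b # bs) (j - r))))"
    by (subst sum.atMost_Suc_shift)
      (auto intro!: sum.cong simp: mult.assoc power_commutes minus_one_power_iff)
  also have "\<dots> = b * elsym (b # bs) (Suc j) - b * (b * elsym bs j)"
    by (simp only: sum_negf sum_distrib_left[symmetric] Suc) simp
  finally show ?case by (simp add: distrib_left)
qed simp

section \<open>Newton's identities for operators commuting up to negligible ones\<close>

context anticomm_quad begin

definition commuting :: "'p opr list \<Rightarrow> bool" where
  "commuting bs \<longleftrightarrow> set bs \<subseteq> ops 0 \<and> (\<forall>b\<in>set bs. \<forall>c\<in>set bs. b * c \<approx> c * b)"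

lemma elsym_ops: "set bs \<subseteq> ops 0 \<Longrightarrow> elsym bs j \<in> ops 0"
  by (induction bs arbitrary: j) (auto split: nat.splits intro: ops_zero ops_one ops_add ops_mult0)

lemma psum_ops: "set bs \<subseteq> ops 0 \<Longrightarrow> psum bs j \<in> ops 0"
  by (induction bs) (auto simp: psum_def intro: ops_zero ops_add ops_power)

lemma sign_ops: "(- 1) ^ r \<in> ops 0"
  by (intro ops_power ops_uminus ops_one)

lemma power_commute_eqv:
  assumes "b \<in> ops 0" "c \<in> ops 0" "c * b \<approx> b * c" shows "c ^ r * b \<approx> b * c ^ r"
proof (induction r)
  case (Suc r)
  have "c * (c ^ r * b) \<approx> c * (b * c ^ r)" by (rule eqv_left[OF assms(2) Suc])
  also have "c * (b * c ^ r) \<approx> (b * c) * c ^ r"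
    unfolding mult.assoc[symmetric] by (rule eqv_right[OF assms(3) ops_power[OF assms(2)]])
  finally show ?case by (simp add: mult.assoc)
qed simp

lemma psum_commute_eqv:
  assumes "commuting (b # bs)" shows "psum bs r * b \<approx> b * psum bs r"
  using assms
proof (induction bs)
  case (Cons c bs)
  have "psum bs r * b \<approx> b * psum bs r" using Cons by (auto simp: commuting_def)
  moreover have "c ^ r * b \<approx> b * c ^ r"
    using Cons.prems by (intro power_commute_eqv) (auto simp: commuting_def)
  ultimately show ?case unfolding psum_def by (simp add: distrib_left distrib_right eqv_add)
qed (simp add: psum_def)

text \<open>The powers of \<open>b\<close> telescope, and the power sums of \<open>bs\<close> are
  treated by the induction hypothesis in degrees \<open>Suc j\<close> and \<open>j\<close>.
  Commutation serves to move \<open>b\<close> to the left of these power sums.\<close>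

lemma newton:
  "commuting bs \<Longrightarrow> of_nat (Suc j) * elsym bs (Suc j) \<approx>
    (\<Sum>r\<le>j. (- 1) ^ r * psum bs (Suc r) * elsym bs (j - r))"
proof (induction bs arbitrary: j)
  case Nil
  then show ?case by (simp add: psum_def)
next
  case (Cons b bs)
  then have bs: "commuting bs" "b \<in> ops 0" "set bs \<subseteq> ops 0" by (auto simp: commuting_def)
  define E P where "E = elsym bs" and "P = psum bs"
  \<comment> \<open>\<open>Em k\<close> is the elementary symmetric function of degree
    \<open>k - 1\<close>, read as zero for \<open>k = 0\<close>.\<close>
  define Em where "Em k = (case k of 0 \<Rightarrow> 0 | Suc i \<Rightarrow> E i)" for k
  have E': "elsym (b # bs) k = E k + b * Em k" for k by (simp add: E_def Em_def split: nat.splits)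
  have P': "psum (b # bs) k = b ^ k + P k" for k by (simp add: P_def psum_def)
  have EmO: "Em k \<in> ops 0" for k
    unfolding Em_def E_def using elsym_ops[OF bs(3)] ops_zero by (auto split: nat.splits)
  have "P (Suc r) * b \<approx> b * P (Suc r)" for r unfolding P_def by (rule psum_commute_eqv[OF Cons.prems])
  then have Pb: "(- 1) ^ r * P (Suc r) * (b * Em (j - r)) \<approx> b * ((- 1) ^ r * P (Suc r) * Em (j - r))" for r
  proof -
    have "(- 1) ^ r * ((P (Suc r) * b) * Em (j - r)) \<approx> (- 1) ^ r * ((b * P (Suc r)) * Em (j - r))"
      by (intro eqv_left sign_ops eqv_right EmO \<open>P (Suc r) * b \<approx> b * P (Suc r)\<close>)
    moreover have "(- 1) ^ r * ((b * P (Suc r)) * Em (j - r)) = b * ((- 1) ^ r * P (Suc r) * Em (j - r))"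
      by (cases "even r") (simp_all add: mult.assoc)
    ultimately show ?thesis by (simp only: mult.assoc)
  qed
  have X: "(\<Sum>r\<le>j. (- 1) ^ r * P (Suc r) * Em (j - r)) \<approx> of_nat j * E j"
  proof (cases j)
    case 0
    then show ?thesis by (simp add: Em_def)
  next
    case (Suc i)
    have "(\<Sum>r\<le>j. (- 1) ^ r * P (Suc r) * Em (j - r)) = (\<Sum>r\<le>i. (- 1) ^ r * P (Suc r) * E (i - r))"
      unfolding Suc by (simp add: Em_def Suc_diff_le)
    moreover have "of_nat (Suc i) * E (Suc i) \<approx> (\<Sum>r\<le>i. (- 1) ^ r * P (Suc r) * E (i - r))"
      unfolding E_def P_def by (rule Cons.IH[OF bs(1)])
    ultimately show ?thesis using Suc eqv_sym by simp
  qed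
  have "(\<Sum>r\<le>j. (- 1) ^ r * P (Suc r) * (b * Em (j - r))) \<approx>
      (\<Sum>r\<le>j. b * ((- 1) ^ r * P (Suc r) * Em (j - r)))"
    by (rule eqv_sum[OF Pb])
  also have "\<dots> = b * (\<Sum>r\<le>j. (- 1) ^ r * P (Suc r) * Em (j - r))" by (rule sum_distrib_left[symmetric])
  also have "\<dots> \<approx> b * (of_nat j * E j)" by (rule eqv_left[OF bs(2) X])
  also have "b * (of_nat j * E j) = of_nat j * (b * E j)"
    by (simp only: mult_of_nat_commute[of j b, symmetric] mult.assoc[symmetric])
  finally have Y: "(\<Sum>r\<le>j. (- 1) ^ r * P (Suc r) * (b * Em (j - r))) \<approx> of_nat j * (b * E j)" .
  have "(\<Sum>r\<le>j. (- 1) ^ r * P (Suc r) * E (j - r)) \<approx> of_nat (Suc j) * E (Suc j)"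
    unfolding E_def P_def by (rule eqv_sym[OF Cons.IH[OF bs(1)]])
  then have "b * E j + (\<Sum>r\<le>j. (- 1) ^ r * P (Suc r) * E (j - r)) +
      (\<Sum>r\<le>j. (- 1) ^ r * P (Suc r) * (b * Em (j - r))) \<approx>
      b * E j + of_nat (Suc j) * E (Suc j) + of_nat j * (b * E j)"
    by (intro eqv_add Y eqv_refl)
  moreover have "(\<Sum>r\<le>j. (- 1) ^ r * psum (b # bs) (Suc r) * elsym (b # bs) (j - r)) =
      (\<Sum>r\<le>j. (- 1) ^ r * b ^ Suc r * elsym (b # bs) (j - r)) +
      (\<Sum>r\<le>j. (- 1) ^ r * P (Suc r) * elsym (b # bs) (j - r))"
    unfolding P' by (simp only: distrib_left distrib_right sum.distrib)
  moreover have "(\<Sum>r\<le>j. (- 1) ^ r * b ^ Suc r * elsym (b # bs) (j - r)) = b * E j"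
    unfolding E_def by (rule elsym_telescope)
  moreover have "(\<Sum>r\<le>j. (- 1) ^ r * P (Suc r) * elsym (b # bs) (j - r)) =
      (\<Sum>r\<le>j. (- 1) ^ r * P (Suc r) * E (j - r)) + (\<Sum>r\<le>j. (- 1) ^ r * P (Suc r) * (b * Em (j - r)))"
    unfolding E' by (simp only: distrib_left sum.distrib)
  moreover have "b * E j + of_nat (Suc j) * E (Suc j) + of_nat j * (b * E j) =
      of_nat (Suc j) * elsym (b # bs) (Suc j)"
    unfolding E' by (simp add: Em_def algebra_simps)
  ultimately show ?case using eqv_sym by (simp only: add.assoc)
qed

text \<open>Below \<open>m\<close> the power sums determine the elementary functions, after division
  by \<open>k\<close> through \<open>negl_torsion\<close>. In degree \<open>m\<close> the product is
  given and beyond it both sides are zero; the identities then yield the higher power sums.\<close>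

lemma newton_transfer:
  assumes bs: "commuting bs" and cs: "commuting cs" and len: "length bs = m" "length cs = m"
    and psum: "\<And>r. r < m \<Longrightarrow> psum bs r \<approx> psum cs r"
    and prod: "prod_list bs \<approx> prod_list cs"
  shows "elsym bs k \<approx> elsym cs k \<and> psum bs k \<approx> psum cs k"
proof (induction k rule: less_induct)
  case (less k)
  have ops: "set bs \<subseteq> ops 0" "set cs \<subseteq> ops 0" using bs cs by (auto simp: commuting_def)
  show ?case
  proof (cases k)
    case 0
    then show ?thesis by (simp add: psum_def sum_list_triv len)
  next
    case (Suc j)
    define R where "R xs = (\<Sum>r<j. (- 1) ^ r * psum xs (Suc r) * elsym xs (j - r))" for xs :: "'p opr list"
    have R: "R bs \<approx> R cs" unfolding R_def
    proof (rule eqv_sum)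
      fix r assume "r \<in> {..<j}"
      then have "psum bs (Suc r) \<approx> psum cs (Suc r)" "elsym bs (j - r) \<approx> elsym cs (j - r)"
        using less Suc by simp_all
      then show "(- 1) ^ r * psum bs (Suc r) * elsym bs (j - r) \<approx> (- 1) ^ r * psum cs (Suc r) * elsym cs (j - r)"
        unfolding mult.assoc by (intro eqv_left sign_ops eqv_mult psum_ops elsym_ops ops)
    qed
    have N: "of_nat k * elsym xs k \<approx> R xs + (- 1) ^ j * psum xs k" if "commuting xs" for xs
      using newton[OF that, of j] by (simp add: R_def Suc flip: lessThan_Suc_atMost)
    have e: "elsym bs k \<approx> elsym cs k"
    proof (cases "k < m")
      case True
      have "of_nat k * elsym bs k \<approx> R bs + (- 1) ^ j * psum bs k" by (rule N[OF bs])
      also have "\<dots> \<approx> R cs + (- 1) ^ j * psum cs k" by (intro eqv_add R eqv_left sign_ops psum[OF True])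
      also have "\<dots> \<approx> of_nat k * elsym cs k" by (rule eqv_sym[OF N[OF cs]])
      finally have "of_nat k * (elsym bs k - elsym cs k) \<in> negl" by (simp add: eqv_def right_diff_distrib)
      then show ?thesis unfolding eqv_def by (rule negl_torsion[rotated]) (simp add: Suc)
    next
      case False
      then show ?thesis
        using prod elsym_length[of bs] elsym_length[of cs] len elsym_beyond[of bs k] elsym_beyond[of cs k]
        by (cases "k = m") auto
    qed
    have p: "(- 1) ^ j * psum xs k \<approx> of_nat k * elsym xs k - R xs" if "commuting xs" for xs
      using N[OF that] negl_uminus[of "of_nat k * elsym xs k - (R xs + (- 1) ^ j * psum xs k)"]
      by (simp add: eqv_def algebra_simps)
    have "(- 1) ^ j * psum bs k \<approx> of_nat k * elsym bs k - R bs" by (rule p[OF bs])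
    also have "\<dots> \<approx> of_nat k * elsym cs k - R cs" by (intro eqv_diff R eqv_left ops_of_nat e)
    also have "\<dots> \<approx> (- 1) ^ j * psum cs k" by (rule eqv_sym[OF p[OF cs]])
    finally have "(- 1) ^ j * ((- 1) ^ j * psum bs k) \<approx> (- 1) ^ j * ((- 1) ^ j * psum cs k)"
      by (rule eqv_left[OF sign_ops])
    then have "psum bs k \<approx> psum cs k" by (cases "even j") simp_all
    with e show ?thesis by blast
  qed
qed

lemma comm_up_1_iff: "comm_up 1 f h \<longleftrightarrow> f * h \<approx> h * f"
  by (simp add: intertwines_def eqv_def)

lemma comm_up_1_sym: "comm_up 1 f h \<Longrightarrow> comm_up 1 h f"
  unfolding comm_up_1_iff by (rule eqv_sym)

text \<open>Reversing the second product makes two equal factors enclose the inner squares; one of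
  them moves past these squares without a sign.\<close>

lemma prod_list_squares:
  assumes "\<And>i j. i \<in> set xs \<Longrightarrow> j \<in> set xs \<Longrightarrow> comm_up 1 (F j * F j) (F i)"
    and ops: "\<And>i. i \<in> set xs \<Longrightarrow> F i \<in> ops 0"
  shows "prod_list (map F xs) * prod_list (map F (rev xs)) \<approx> prod_list (map (\<lambda>i. F i * F i) xs)"
  using assms
proof (induction xs)
  case (Cons i xs)
  define Q where "Q = prod_list (map (\<lambda>i. F i * F i) xs)"
  have F: "F i \<in> ops 0" by (rule Cons.prems(2)) simp
  have Q: "Q \<in> ops 0" unfolding Q_def
    by (rule ops_prod_list) (use Cons.prems(2) in \<open>auto intro!: ops_mult0\<close>)
  have "Q * F i \<approx> F i * Q"
  proof -
    have "comm_up 1 (F i) (F k * F k)" "F k * F k \<in> ops 0" if "k \<in> set xs" for k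
      using comm_up_1_sym[OF Cons.prems(1)[of i k]] ops_mult0 Cons.prems(2)[of k] that by auto
    then have "intertwines (1 ^ length xs) (F i) Q Q"
      unfolding Q_def by (intro intertwines_prod_list) blast
    then have "F i * Q \<approx> Q * F i" by (simp add: comm_up_1_iff)
    then show ?thesis by (rule eqv_sym)
  qed
  have "prod_list (map F xs) * prod_list (map F (rev xs)) \<approx> Q"
    unfolding Q_def by (rule Cons.IH) (rule Cons.prems; simp)+
  then have "F i * (prod_list (map F xs) * prod_list (map F (rev xs)) * F i) \<approx> F i * (Q * F i)"
    by (intro eqv_left eqv_right F)
  also have "\<dots> \<approx> F i * (F i * Q)" by (rule eqv_left[OF F \<open>Q * F i \<approx> F i * Q\<close>])
  finally show ?case by (simp add: Q_def mult.assoc)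
qed simp

section \<open>Power sums of the squares\<close>

lemma intertwines_sum:
  "(\<And>s. s \<in> S \<Longrightarrow> intertwines c f (F s) (F' s)) \<Longrightarrow> intertwines c f (sum F S) (sum F' S)"
  using negl_sum[of S "\<lambda>s. f * F s - of_int c * (F' s * f)"]
  by (simp add: intertwines_def sum_distrib_left sum_distrib_right sum_subtractf)

lemma intertwines_power:
  "intertwines 1 f h h' \<Longrightarrow> h \<in> ops 0 \<Longrightarrow> h' \<in> ops 0 \<Longrightarrow> intertwines 1 f (h ^ k) (h' ^ k)"
  using intertwines_prod_list[of "replicate k ()" 1 f "\<lambda>_. h" "\<lambda>_. h'"] by (simp add: map_replicate_const)

abbreviation Asq :: "nat \<Rightarrow> 'p opr" where
  "Asq i \<equiv> Aop i * Aop i"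

abbreviation xsq :: "nat set \<Rightarrow> nat \<Rightarrow> 'p opr" where
  "xsq U i \<equiv> xop U i * xop U i"

lemma Asq_ops: "Asq i \<in> ops 0"
  by (intro ops_mult0 Aop_ops)

lemma Asq_Aop: "i \<in> V \<Longrightarrow> j \<in> V \<Longrightarrow> comm_up 1 (Asq i) (Aop j)"
proof (cases "i = j")
  case True
  then show ?thesis by (simp add: intertwines_def mult.assoc negl_zero)
next
  case False
  assume "i \<in> V" "j \<in> V"
  with False show ?thesis
    using comm_up_square[of 1 "Aop i" "Aop j"] Aop_comm_up[of i j] Aop_ops by simp
qed

text \<open>Passing \<open>Zop j l\<close> permutes the squares of the parameters without sign, and
  the power sum is symmetric.\<close>

lemma xop_sum_Asq:
  assumes U: "U \<subseteq> V" and j: "j \<in> U"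
  shows "comm_up 1 (xop U j) (\<Sum>i\<in>U. Asq i ^ k)"
  unfolding xop_def theta_op_def
proof (intro comm_up_add comm_up_sum)
  have "comm_up 1 (Aop j) (Asq i ^ k)" if "i \<in> U" for i
    using that U j by (intro intertwines_power comm_up_1_sym[OF Asq_Aop] Asq_ops) auto
  then show "comm_up 1 (Aop j) (\<Sum>i\<in>U. Asq i ^ k)" by (intro intertwines_sum)
next
  fix l assume l: "l \<in> U - {j}"
  let ?s = "transpose j l"
  have "intertwines 1 (Zop j l) (Asq i ^ k) (Asq (?s i) ^ k)" if i: "i \<in> U" for i
  proof (intro intertwines_power Asq_ops)
    have "intertwines (- 1) (Zop j l) (Aop i) (Aop (?s i))"
      using Zop_Aop[of j l i] i j l U by (auto simp: intertwines_def)
    then show "intertwines 1 (Zop j l) (Asq i) (Asq (?s i))"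
      using intertwines_mult[of "- 1" "Zop j l" "Aop i" "Aop (?s i)" "- 1"] Aop_ops by simp
  qed
  then have "intertwines 1 (Zop j l) (\<Sum>i\<in>U. Asq i ^ k) (\<Sum>i\<in>U. Asq (?s i) ^ k)"
    by (rule intertwines_sum)
  moreover have "(\<Sum>i\<in>U. Asq (?s i) ^ k) = (\<Sum>i\<in>U. Asq i ^ k)"
    by (rule sum.reindex_bij_betw[OF permutes_imp_bij[OF permutes_swap_id]]) (use j l in auto)
  ultimately show "comm_up 1 (Zop j l) (\<Sum>i\<in>U. Asq i ^ k)" by simp
qed

lemma comm_up_xop:
  assumes "U \<subseteq> V" "j \<in> U" "comm_up 1 (xop U j) h" shows "comm_up 1 (xsq U j) h"
  using comm_up_mult[OF assms(3,3) xop_ops[OF assms(1,2)] xop_ops[OF assms(1,2)]] by simp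

lemma xsq_ops: "U \<subseteq> V \<Longrightarrow> i \<in> U \<Longrightarrow> xsq U i \<in> ops 0"
  by (intro ops_mult0 xop_ops)

lemma xsq_xsq:
  assumes "U \<subseteq> V" "i \<in> U" "j \<in> U" shows "comm_up 1 (xsq U i) (xsq U j)"
proof -
  have "comm_up 1 (xsq U i) (xop U j)" using assms by (intro xop_square_xop)
  from intertwines_mult[OF this this] show ?thesis using xop_ops[OF assms(1,3)] by simp
qed

text \<open>The part of the power sum of the squares consisting of the words with support exactly \<open>U\<close>.\<close>
definition full_words :: "nat set \<Rightarrow> nat \<Rightarrow> (nat \<times> nat list) set" where
  "full_words U k = {(i, as). length as = 2 * k \<and> insert i (set as) = U}"

definition full_sum :: "nat set \<Rightarrow> nat \<Rightarrow> 'p opr" where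
  "full_sum U k = (\<Sum>(i, as)\<in>full_words U k. opword (map (Pair i) as))"

lemma power_xsq:
  assumes "U \<subseteq> V" "i \<in> U"
  shows "xsq U i ^ k = (\<Sum>as\<in>words U (2 * k). opword (map (Pair i) as))"
proof -
  have "set (replicate (2 * k) i) \<subseteq> U" using assms(2) by auto
  note sum = prod_list_xop[OF assms(1) this]
  have "xsq U i ^ k = prod_list (map (xop U) (replicate (2 * k) i))"
    by (simp add: power_mult power2_eq_square)
  also have "\<dots> = (\<Sum>as\<in>words U (2 * k). opword (zip (replicate (2 * k) i) as))"
    using sum by (simp only: length_replicate)
  also have "\<dots> = (\<Sum>as\<in>words U (2 * k). opword (map (Pair i) as))"
  proof (rule sum.cong[OF refl])
    fix as assume "as \<in> words U (2 * k)"
    then have "zip (replicate (2 * k) i) as = map (Pair i) as"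
      using zip_replicate1[of "2 * k" i as] by simp
    then show "opword (zip (replicate (2 * k) i) as) = opword (map (Pair i) as)" by (rule arg_cong)
  qed
  finally show ?thesis .
qed

text \<open>The operator of a word does not depend on the ambient set, so words can be grouped by
  the indices occurring in them, the centre included.\<close>

lemma sum_xsq:
  assumes U: "U \<subseteq> V" shows "(\<Sum>i\<in>U. xsq U i ^ k) = (\<Sum>U'\<in>Pow U. full_sum U' k)"
proof -
  have fin: "finite U" using U finite_V finite_subset by blast
  define D where "D = U \<times> words U (2 * k)"
  have D: "finite D" unfolding D_def by (intro finite_cartesian_product fin finite_lists_length_eq)
  let ?h = "\<lambda>(i, as). opword (map (Pair i) as)" and ?g = "\<lambda>(i, as). insert i (set as)"
  have "(\<Sum>i\<in>U. xsq U i ^ k) = (\<Sum>i\<in>U. \<Sum>as\<in>words U (2 * k). opword (map (Pair i) as))"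
    by (rule sum.cong[OF refl power_xsq[OF U]])
  also have "\<dots> = sum ?h D" unfolding D_def by (rule sum.cartesian_product)
  also have "\<dots> = (\<Sum>U'\<in>Pow U. sum ?h {x \<in> D. ?g x = U'})"
    by (rule sum.group[symmetric, OF D]) (use fin in \<open>auto simp: D_def\<close>)
  also have "\<dots> = (\<Sum>U'\<in>Pow U. full_sum U' k)"
  proof (rule sum.cong[OF refl])
    fix U' assume "U' \<in> Pow U"
    then have "{x \<in> D. ?g x = U'} = full_words U' k" by (auto simp: D_def full_words_def)
    then show "sum ?h {x \<in> D. ?g x = U'} = full_sum U' k" by (simp only: full_sum_def)
  qed
  finally show ?thesis .
qed

lemma full_sum_single: "full_sum {i} k = Asq i ^ k"
proof -
  have "full_words {i} k = {(i, replicate (2 * k) i)}"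
    by (auto simp: full_words_def intro: replicate_eqI)
  then show ?thesis by (simp add: full_sum_def opword_def hop_def power_mult power2_eq_square)
qed

lemma full_sum_empty: "full_sum {} k = 0"
  by (simp add: full_sum_def full_words_def)

text \<open>A support with one element contains no transposition and gives a power of a squared
  parameter; the empty support contributes zero.\<close>

lemma sum_xsq_minus:
  assumes U: "U \<subseteq> V" "2 \<le> card U"
    and negl: "\<And>U'. U' \<subset> U \<Longrightarrow> 2 \<le> card U' \<Longrightarrow> full_sum U' k \<in> negl"
  shows "(\<Sum>i\<in>U. xsq U i ^ k) \<approx> full_sum U k + (\<Sum>i\<in>U. Asq i ^ k)"
proof -
  have fin: "finite U" using U(1) finite_V finite_subset by blast
  define h where "h U' = (if card U' = 1 then full_sum U' k else 0)" for U'
  have "full_sum U' k \<approx> h U'" if "U' \<in> Pow U - {U}" for U'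
  proof -
    have "finite U'" using that fin finite_subset by blast
    then consider "U' = {}" | "card U' = 1" | "2 \<le> card U'" by (cases "card U'"; cases "card U' - 1") auto
    then show ?thesis
      using negl[of U'] that by cases (auto simp: h_def full_sum_empty eqv_zero_iff)
  qed
  then have "(\<Sum>U'\<in>Pow U - {U}. full_sum U' k) \<approx> (\<Sum>U'\<in>Pow U - {U}. h U')" by (rule eqv_sum)
  also have "(\<Sum>U'\<in>Pow U - {U}. h U') = (\<Sum>U'\<in>(\<lambda>i. {i}) ` U. h U')"
  proof (rule sum.mono_neutral_right)
    show "(\<lambda>i. {i}) ` U \<subseteq> Pow U - {U}" using U(2) by auto
    show "\<forall>U'\<in>Pow U - {U} - (\<lambda>i. {i}) ` U. h U' = 0" by (auto simp: h_def card_1_singleton_iff)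
  qed (use fin in auto)
  also have "\<dots> = (\<Sum>i\<in>U. Asq i ^ k)"
    by (subst sum.reindex) (auto simp: h_def full_sum_single)
  finally have "full_sum U k + (\<Sum>U'\<in>Pow U - {U}. full_sum U' k) \<approx> full_sum U k + (\<Sum>i\<in>U. Asq i ^ k)"
    by (rule eqv_add[OF eqv_refl])
  then show ?thesis
    using sum.remove[of "Pow U" U "\<lambda>U'. full_sum U' k"] fin sum_xsq[OF U(1), of k] by simp
qed

text \<open>By \<open>rigidity\<close> only words with trivial product count. Such a word reaches
  all other indices with at most \<open>2 * k\<close> proper letters, so two equal letters are
  adjacent and their square lies in \<open>I\<close>.\<close>

lemma full_sum_negl_low:
  assumes U: "U \<subseteq> V" "2 \<le> card U" and k: "k < card U"
    and sum: "(\<Sum>i\<in>U. xsq U i ^ k) \<approx> full_sum U k + (\<Sum>i\<in>U. Asq i ^ k)"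
  shows "full_sum U k \<in> negl"
proof (rule rigidity[OF U(1)])
  have word: "insert i (set as) = U" "length as = 2 * k" if "(i, as) \<in> full_words U k" for i as
    using that by (auto simp: full_words_def)
  show ops: "full_sum U k \<in> ops 0"
    unfolding full_sum_def
  proof (rule ops_sum, clarify)
    fix i as assume "(i, as) \<in> full_words U k"
    then show "opword (map (Pair i) as) \<in> ops 0"
      using word U(1) by (intro opword_ops) fastforce
  qed
  fix j assume j: "j \<in> U"
  \<comment> \<open>Up to the negligible \<open>N\<close>, the full sum is the difference of two
    power sums, each of which commutes with \<open>xsq U j\<close>.\<close>
  define N where "N = (\<Sum>i\<in>U. xsq U i ^ k) - (full_sum U k + (\<Sum>i\<in>U. Asq i ^ k))"
  have N: "N \<in> negl" using sum by (simp add: N_def eqv_def)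
  have xj: "xsq U j \<in> ops 0" by (rule xsq_ops[OF U(1) j])
  have "comm_up 1 (xsq U j) N"
    unfolding comm_up_1_iff eqv_def by (intro negl_diff negl_left negl_right xj N)
  moreover have "comm_up 1 (xsq U j) (\<Sum>i\<in>U. Asq i ^ k)"
    by (intro comm_up_xop xop_sum_Asq U(1) j)
  moreover have "comm_up 1 (xsq U j) (\<Sum>i\<in>U. xsq U i ^ k)"
    by (intro intertwines_sum intertwines_power xsq_xsq xsq_ops U(1) j)
  ultimately have "comm_up 1 (xsq U j) ((\<Sum>i\<in>U. xsq U i ^ k) - (\<Sum>i\<in>U. Asq i ^ k) - N)"
    by (intro comm_up_diff_right)
  then show "xsq U j * full_sum U k - full_sum U k * xsq U j \<in> negl"
    by (simp add: comm_up_1_iff eqv_def N_def)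
next
  fix v d g T assume v: "v \<in> supp 0" "good g"
    and vanish: "\<And>d' g' T'. \<exists>j\<in>U. g' j \<noteq> g j \<Longrightarrow> v (d', g', T') = 0"
  show "app (full_sum U k) v (d, g, T) \<in> I"
    unfolding full_sum_def app_sum
  proof (rule I_sum, clarify)
    fix i as assume "(i, as) \<in> full_words U k"
    then have ias: "insert i (set as) = U" "length as = 2 * k" by (auto simp: full_words_def)
    define ts where "ts = map (Pair i) as"
    have ts: "fst ` set ts \<union> snd ` set ts \<subseteq> U" using ias(1) by (auto simp: ts_def)
    define cs where "cs = filter (\<lambda>a. i \<noteq> a) as"
    have cs: "proper ts = map (Pair i) cs" by (simp add: ts_def cs_def filter_map o_def)
    have set: "set cs = U - {i}" using ias(1) by (auto simp: cs_def)
    have "i \<in> U" using ias(1) by blast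
    with set have card: "card (set cs) = card U - 1" by (simp add: card_Diff_singleton)
    show "app (opword (map (Pair i) as)) v (d, g, T) \<in> I"
      unfolding ts_def[symmetric]
    proof (rule opword_diagonal[OF U(1) ts v vanish])
      assume "word_perm ts = id"
      then have "word_perm (map (Pair i) cs) = id" by (simp add: word_perm_filter_proper flip: cs)
      \<comment> \<open>Here \<open>k < card U\<close> enters, as
        \<open>k \<le> card U - 1\<close>.\<close>
      moreover have "length cs \<le> 2 * card (set cs)"
        using length_filter_le[of "\<lambda>a. i \<noteq> a" as] ias(2) k card by (simp add: cs_def)
      moreover have "cs \<noteq> []" using card U(2) by auto
      moreover have "i \<notin> set cs" by (simp add: cs_def)
      ultimately obtain us a vs where "cs = us @ a # a # vs" by (elim star_word_adjacent[rotated])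
      then have eq: "proper ts = map (Pair i) us @ (i, a) # (i, a) # map (Pair i) vs" by (simp add: cs)
      have "\<forall>t\<in>set (proper ts). fst t \<in> V \<and> snd t \<in> V \<and> fst t \<noteq> snd t"
        using ts U(1) by fastforce
      then show "zlist (proper ts) \<in> I" unfolding eq by (rule zlist_adjacent)
    qed
  qed
qed

lemma psum_map: "distinct xs \<Longrightarrow> psum (map F xs) k = (\<Sum>i\<in>set xs. F i ^ k)"
  by (simp add: psum_def sum_list_distinct_conv_sum_set o_def)

text \<open>The product needed by \<open>newton_transfer\<close> comes from
  \<open>prod_list_xop_eqv\<close> for \<open>xs\<close> and for \<open>rev xs\<close>, whose two
  products multiply to the product of the squares.\<close>

lemma sum_xsq_transfer:
  assumes xs: "distinct xs" "set xs \<subseteq> V"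
    and low: "\<And>r. r < length xs \<Longrightarrow> (\<Sum>i\<in>set xs. xsq (set xs) i ^ r) \<approx> (\<Sum>i\<in>set xs. Asq i ^ r)"
  shows "elsym (map (xsq (set xs)) xs) k \<approx> elsym (map Asq xs) k \<and>
    (\<Sum>i\<in>set xs. xsq (set xs) i ^ k) \<approx> (\<Sum>i\<in>set xs. Asq i ^ k)"
proof -
  define U where "U = set xs"
  have U: "U \<subseteq> V" using xs(2) by (simp add: U_def)
  have xsqU: "comm_up 1 (xsq U i) (xop U j)" "comm_up 1 (xsq U i) (xsq U j)" if "i \<in> U" "j \<in> U" for i j
    using xop_square_xop[OF U that(2,1)] xsq_xsq[OF U that] by blast+
  have AsqU: "comm_up 1 (Asq i) (Aop j)" "comm_up 1 (Asq i) (Asq j)" if "i \<in> U" "j \<in> U" for i j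
  proof -
    show *: "comm_up 1 (Asq i) (Aop j)" using that U by (intro Asq_Aop) auto
    then show "comm_up 1 (Asq i) (Asq j)" using intertwines_mult[OF * *] Aop_ops by simp
  qed
  have "prod_list (map (xsq U) xs) \<approx> prod_list (map (xop U) xs) * prod_list (map (xop U) (rev xs))"
    using xsqU(1) xop_ops[OF U] by (intro eqv_sym[OF prod_list_squares]) (auto simp: U_def)
  also have "\<dots> \<approx> prod_list (map Aop xs) * prod_list (map Aop (rev xs))"
  proof (rule eqv_mult)
    show "prod_list (map (xop U) xs) \<approx> prod_list (map Aop xs)"
      unfolding U_def by (rule prod_list_xop_eqv[OF xs])
    show "prod_list (map (xop U) (rev xs)) \<approx> prod_list (map Aop (rev xs))"
      using prod_list_xop_eqv[of "rev xs"] xs by (simp add: U_def)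
    show "prod_list (map (xop U) (rev xs)) \<in> ops 0"
      using xop_ops[OF U] by (intro ops_prod_list) (auto simp: U_def)
  qed (rule Aop_prod_list_ops)
  also have "\<dots> \<approx> prod_list (map Asq xs)"
    using AsqU(1) by (intro prod_list_squares Aop_ops) (auto simp: U_def)
  finally have prod: "prod_list (map (xsq U) xs) \<approx> prod_list (map Asq xs)" .
  have "elsym (map (xsq U) xs) k \<approx> elsym (map Asq xs) k \<and> psum (map (xsq U) xs) k \<approx> psum (map Asq xs) k"
  proof (rule newton_transfer[OF _ _ _ _ _ prod])
    show "commuting (map (xsq U) xs)"
      using xsqU(2) xop_ops[OF U] unfolding commuting_def comm_up_1_iff by (auto simp: U_def intro: ops_mult0)
    show "commuting (map Asq xs)"
      using AsqU(2) unfolding commuting_def comm_up_1_iff by (auto simp: U_def intro: Asq_ops)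
  qed (use low xs(1) in \<open>auto simp: psum_map U_def\<close>)
  then show ?thesis using xs(1) by (simp add: psum_map U_def)
qed

text \<open>By induction on \<open>card U\<close>, \<open>full_sum U k\<close> is the difference of
  the two power sums. For \<open>k < card U\<close> it vanishes by rigidity, and Newton's identities
  extend this to all \<open>k\<close>.\<close>

lemma full_sum_negl:
  assumes "U \<subseteq> V" "2 \<le> card U" shows "full_sum U k \<in> negl"
  using assms
proof (induction "card U" arbitrary: U k rule: less_induct)
  case less
  have fin: "finite U" using less.prems(1) finite_V finite_subset by blast
  have sum: "(\<Sum>i\<in>U. xsq U i ^ r) \<approx> full_sum U r + (\<Sum>i\<in>U. Asq i ^ r)" for r
  proof (rule sum_xsq_minus[OF less.prems])
    fix U' assume "U' \<subset> U" "2 \<le> card U'"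
    then show "full_sum U' r \<in> negl"
      using less.hyps[of U'] psubset_card_mono[OF fin] less.prems(1) by auto
  qed
  have low: "(\<Sum>i\<in>U. xsq U i ^ r) \<approx> (\<Sum>i\<in>U. Asq i ^ r)" if "r < card U" for r
  proof -
    have "full_sum U r \<approx> 0" unfolding eqv_zero_iff by (rule full_sum_negl_low[OF less.prems that sum])
    from eqv_trans[OF sum eqv_add[OF this eqv_refl]] show ?thesis by (simp only: add_0)
  qed
  obtain xs where xs: "set xs = U" "distinct xs" using finite_distinct_list[OF fin] by blast
  then have len: "length xs = card U" by (metis distinct_card)
  have "(\<Sum>i\<in>U. xsq U i ^ k) \<approx> (\<Sum>i\<in>U. Asq i ^ k)"
    using sum_xsq_transfer[OF xs(2), unfolded xs(1) len, OF less.prems(1) low] by blast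
  then have "full_sum U k + (\<Sum>i\<in>U. Asq i ^ k) \<approx> (\<Sum>i\<in>U. Asq i ^ k)"
    by (rule eqv_trans[OF eqv_sym[OF sum]])
  then show ?case by (simp add: eqv_def)
qed

theorem elsym_xsq_eqv:
  assumes "distinct xs" "set xs \<subseteq> V" "2 \<le> length xs"
  shows "elsym (map (xsq (set xs)) xs) k \<approx> elsym (map Asq xs) k"
proof -
  have card: "2 \<le> card (set xs)" using assms by (simp add: distinct_card)
  have "(\<Sum>i\<in>set xs. xsq (set xs) i ^ r) \<approx> (\<Sum>i\<in>set xs. Asq i ^ r)" for r
  proof -
    have z: "full_sum (set xs) r \<approx> 0"
      unfolding eqv_zero_iff by (rule full_sum_negl[OF assms(2) card])
    have "(\<Sum>i\<in>set xs. xsq (set xs) i ^ r) \<approx> full_sum (set xs) r + (\<Sum>i\<in>set xs. Asq i ^ r)"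
    proof (rule sum_xsq_minus[OF assms(2) card])
      fix U' assume "U' \<subset> set xs" "2 \<le> card U'"
      with assms(2) show "full_sum U' r \<in> negl" by (intro full_sum_negl) auto
    qed
    from eqv_trans[OF this eqv_add[OF z eqv_refl]] show ?thesis by (simp only: add_0)
  qed
  then show ?thesis using sum_xsq_transfer[OF assms(1,2)] by blast
qed

end

section \<open>Comparison in top degree\<close>

text \<open>The sign counts the factors to the right of the omitted one. This is the linear part in
  \<tau> of the product of the \<open>F i + \<tau>\<close> when \<tau> anticommutes with every
  \<open>F i\<close> and is moved to the right.\<close>

primrec omit_sum :: "('b \<Rightarrow> 'a::ring_1) \<Rightarrow> 'b list \<Rightarrow> 'a" where
  "omit_sum F [] = 0"
| "omit_sum F (i # xs) = (- 1) ^ length xs * prod_list (map F xs) + F i * omit_sum F xs"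

section \<open>Top components of operators applied to unit vectors\<close>

context anticomm_quad begin
definition tz :: "nat \<Rightarrow> 'p" where
  "tz i = (\<Sum>j\<in>V - {i}. z i j)"

text \<open>Each \<open>Zop\<close> toggles the generator \<open>0\<close>, so values starting at
  the set \<open>T\<close> sit at \<open>shift T d\<close> after \<open>d\<close>
  transpositions.\<close>

definition shift :: "nat set \<Rightarrow> nat \<Rightarrow> nat set" where
  "shift T d = (if even d then T else sym_diff T {0})"

text \<open>
  Since \<open>w\<close> has weight zero, \<open>\<tau>\<close> only moves values from sets containing \<open>w\<close> to sets without it,
  and starting from \<open>unit_at {w}\<close> the \<open>\<tau>\<close>-linear part appears at the sets without \<open>w\<close>.
\<close>
definition unit_at :: "nat set \<Rightarrow> state \<Rightarrow> 'p" where
  "unit_at T0 = (\<lambda>(d, g, T). if d = 0 \<and> good g \<and> T = T0 then 1 else 0)"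

definition leading :: "nat set \<Rightarrow> nat \<Rightarrow> 'p \<Rightarrow> (state \<Rightarrow> 'p) \<Rightarrow> bool" where
  "leading T0 d p f \<longleftrightarrow> (\<forall>e g T. e > d \<longrightarrow> f (e, g, T) = 0) \<and>
    (\<forall>g T. f (d, g, T) = (if good g \<and> T = shift T0 d then p else 0))"

lemma shift_Suc: "sym_diff T {0} = shift T0 d \<longleftrightarrow> T = shift T0 (Suc d)"
  unfolding shift_def by (auto; blast)

lemma unit_at_supp: "unit_at T0 \<in> supp 0"
  by (simp add: unit_at_def supp_def C_zero C_one)

lemma leading_unit_at: "leading T0 0 1 (unit_at T0)"
  by (auto simp: leading_def unit_at_def shift_def)

lemma app_xop: "app (xop V i) f (d, g, T) = cl (g i) (\<lambda>S. f (d, g, S)) T + cl w (\<lambda>S. f (d, g, S)) T +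
    (\<Sum>j\<in>V - {i}. app (Zop i j) f (d, g, T))"
  by (simp add: xop_def theta_op_def plus_opr.rep_eq app_Aop app_sum)

text \<open>Degree counts transpositions: the parameters preserve it, and \<open>f\<close> vanishes
  in degree \<open>Suc d\<close>, so only the \<open>Zop\<close> summands reach the new top.\<close>

lemma leading_xop:
  assumes i: "i \<in> V" and f: "leading T0 d p f"
  shows "leading T0 (Suc d) (tz i * p) (app (xop V i) f)"
proof -
  have zero: "f (e, g, T) = 0" if "e > d" for e g T using f that by (auto simp: leading_def)
  have f_top: "f (d, g, T) = (if good g \<and> T = shift T0 d then p else 0)" for g T
    using f unfolding leading_def by blast
  have "app (xop V i) f (Suc e, g, T) = 0" if "e > d" for e g T
    using that by (simp add: app_xop zero clif_zero)
  then have "app (xop V i) f (e, g, T) = 0" if "e > Suc d" for e g T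
    using that by (cases e) auto
  moreover have "app (xop V i) f (Suc d, g, T) = (if good g \<and> T = shift T0 (Suc d) then tz i * p else 0)" for g T
  proof -
    have "app (xop V i) f (Suc d, g, T) =
        (\<Sum>j\<in>V - {i}. z i j * (if good g \<and> T = shift T0 (Suc d) then p else 0))"
      unfolding app_xop using i
      by (auto simp: zero clif_zero f_top shift_Suc good_transpose intro!: sum.cong)
    then show ?thesis by (simp add: tz_def sum_distrib_right)
  qed
  ultimately show ?thesis unfolding leading_def by blast
qed

lemma leading_add: "leading T0 d p f \<Longrightarrow> leading T0 d q f' \<Longrightarrow> leading T0 d (p + q) (\<lambda>x. f x + f' x)"
  by (auto simp: leading_def)

lemma leading_zero: "leading T0 d 0 (\<lambda>x. 0)"
  by (auto simp: leading_def)

lemma leading_prod_list: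
  "set xs \<subseteq> V \<Longrightarrow> leading T0 (length xs) (prod_list (map tz xs)) (app (prod_list (map (xop V) xs)) (unit_at T0))"
  by (induction xs) (auto simp: one_opr.rep_eq times_opr.rep_eq leading_unit_at leading_xop)

lemma leading_elsym:
  "set xs \<subseteq> V \<Longrightarrow> leading T0 (2 * k) (elsym (map (\<lambda>i. tz i * tz i) xs) k)
    (app (elsym (map (xsq V) xs) k) (unit_at T0))"
proof (induction xs arbitrary: k)
  case Nil
  then show ?case by (auto simp: one_opr.rep_eq zero_opr.rep_eq leading_unit_at leading_zero)
next
  case (Cons i xs)
  show ?case
  proof (cases k)
    case 0
    then show ?thesis using Cons.IH[of 0] Cons.prems by simp
  next
    case (Suc j)
    have "leading T0 (Suc (Suc (2 * j))) (tz i * (tz i * elsym (map (\<lambda>i. tz i * tz i) xs) j))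
        (app (xop V i) (app (xop V i) (app (elsym (map (xsq V) xs) j) (unit_at T0))))"
      using Cons by (intro leading_xop) auto
    then have "leading T0 (2 * k) (tz i * tz i * elsym (map (\<lambda>i. tz i * tz i) xs) j)
        (app (xop V i) (app (xop V i) (app (elsym (map (xsq V) xs) j) (unit_at T0))))"
      by (simp add: Suc mult.assoc)
    moreover have "leading T0 (2 * k) (elsym (map (\<lambda>i. tz i * tz i) xs) k)
        (app (elsym (map (xsq V) xs) k) (unit_at T0))"
      using Cons by simp
    ultimately show ?thesis
      using leading_add unfolding Suc by (simp add: plus_opr.rep_eq times_opr.rep_eq)
  qed
qed

section \<open>Comparison with vectors concentrated in degree zero\<close>

definition flat :: "(state \<Rightarrow> 'p) \<Rightarrow> bool" where
  "flat f \<longleftrightarrow> (\<forall>d g T. 0 < d \<longrightarrow> f (d, g, T) = 0)"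

lemma flat_Aop: "flat f \<Longrightarrow> flat (app (Aop i) f)"
  by (simp add: flat_def app_Aop clif_zero)

lemma flat_unit_at: "flat (unit_at T0)"
  by (simp add: flat_def unit_at_def)

lemma flat_prod_list: "flat (app (prod_list (map Aop xs)) (unit_at T0))"
  by (induction xs) (simp_all add: one_opr.rep_eq times_opr.rep_eq flat_unit_at flat_Aop)

lemma flat_elsym: "flat (app (elsym (map Asq xs) k) (unit_at T0))"
proof (induction xs arbitrary: k)
  case Nil
  then show ?case using flat_unit_at by (simp add: one_opr.rep_eq zero_opr.rep_eq) (simp add: flat_def)
next
  case (Cons i xs)
  have "flat (\<lambda>x. f x + f' x)" if "flat f" "flat f'" for f f' using that by (simp add: flat_def)
  then show ?case
    using Cons flat_Aop flat_unit_at
    by (auto simp: one_opr.rep_eq plus_opr.rep_eq times_opr.rep_eq zero_opr.rep_eq split: nat.splits)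
qed

lemma eqv_top:
  assumes "f \<approx> h" "leading T0 d p (app f (unit_at T0))" "flat (app h (unit_at T0))" "0 < d"
  shows "p \<in> I"
proof -
  have "app (f - h) (unit_at T0) (d, id, shift T0 d) \<in> I"
    using assms(1) by (intro negl_app unit_at_supp) (simp_all add: eqv_def permutes_id)
  then show ?thesis using assms(2-4) by (simp add: minus_opr.rep_eq leading_def flat_def permutes_id)
qed

text \<open>One degree below the top, exactly one factor contributes a parameter. Passing from sets
  with \<open>w\<close> to sets without it forces this contribution to be \<tau>.\<close>

lemma omit_top:
  "set xs \<subseteq> V \<Longrightarrow> good g \<Longrightarrow> xs \<noteq> [] \<Longrightarrow>
    app (prod_list (map (xop V) xs)) (unit_at {w}) (length xs - 1, g, shift {} (length xs - 1)) = omit_sum tz xs"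
proof (induction xs arbitrary: g)
  case (Cons i xs)
  define f where "f = app (prod_list (map (xop V) xs)) (unit_at {w})"
  define d where "d = length xs"
  have i: "i \<in> V" and xs: "set xs \<subseteq> V" using Cons.prems by auto
  have "g i \<in> V" by (rule good_range[OF Cons.prems(2) i])
  then have gi: "g i \<noteq> w" "g i \<noteq> 0" using w_V V_pos by metis+
  have f: "leading {w} d (prod_list (map tz xs)) f" unfolding f_def d_def by (rule leading_prod_list[OF xs])
  have w_shift: "w \<notin> shift {} d" using w_pos by (auto simp: shift_def)
  have "cl (g i) (\<lambda>S. f (d, g, S)) (shift {} d) = 0"
  proof -
    have "sym_diff (shift {} d) {g i} \<noteq> shift {w} d" using gi w_pos by (auto simp: shift_def)
    then show ?thesis using f by (simp add: clif_def leading_def)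
  qed
  moreover have "cl w (\<lambda>S. f (d, g, S)) (shift {} d) = (- 1) ^ d * prod_list (map tz xs)"
  proof -
    \<comment> \<open>\<open>shift {} d\<close> is empty or \<open>{0}\<close> according to the
      parity of \<open>d\<close>, and \<open>0 < w\<close>; this produces the sign.\<close>
    have "{t \<in> shift {} d. t < w} = shift {} d" using w_pos by (auto simp: shift_def)
    then have "(- 1) ^ card {t \<in> shift {} d. t < w} = ((- 1) ^ d :: int)"
      by (auto simp: shift_def)
    moreover have "sym_diff (shift {} d) {w} = shift {w} d" using w_pos by (auto simp: shift_def)
    ultimately show ?thesis
      using f Cons.prems(2) w_shift by (simp add: clif_def clif_coeff_def leading_def)
  qed
  moreover have "(\<Sum>j\<in>V - {i}. app (Zop i j) f (d, g, shift {} d)) = tz i * omit_sum tz xs"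
  proof (cases d)
    case 0
    then show ?thesis by (simp add: d_def)
  next
    case d: (Suc e)
    have "sym_diff (shift {} d) {0} = shift {} e" by (auto simp: shift_def d)
    moreover have "f (e, g \<circ> transpose i j, shift {} e) = omit_sum tz xs" if "j \<in> V" for j
    proof -
      have "good (g \<circ> transpose i j)" unfolding good_transpose[OF i that] by (rule Cons.prems(2))
      moreover have "xs \<noteq> []" using d by (auto simp: d_def)
      moreover have "length xs - 1 = e" using d by (simp add: d_def)
      ultimately show ?thesis using Cons.IH[OF xs] unfolding f_def by metis
    qed
    ultimately show ?thesis by (simp add: d tz_def sum_distrib_right)
  qed
  ultimately show ?case
    by (simp add: times_opr.rep_eq app_xop flip: f_def d_def)
qed simp

section \<open>The three vanishing statements modulo the ideal\<close>

lemma tz_elsym: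
  assumes "distinct xs" "set xs = V" "2 \<le> length xs" "0 < k"
  shows "elsym (map (\<lambda>i. tz i * tz i) xs) k \<in> I"
  using eqv_top[OF elsym_xsq_eqv[of xs k, unfolded assms(2)] leading_elsym flat_elsym] assms by simp

lemma tz_prod_list:
  assumes "distinct xs" "set xs = V" "xs \<noteq> []" shows "prod_list (map tz xs) \<in> I"
  using eqv_top[OF prod_list_xop_eqv[of xs, unfolded assms(2)] leading_prod_list flat_prod_list] assms by simp

lemma tz_omit_sum:
  assumes "distinct xs" "set xs = V" "2 \<le> length xs" shows "omit_sum tz xs \<in> I"
proof -
  let ?d = "length xs - 1"
  have "app (prod_list (map (xop V) xs) - prod_list (map Aop xs)) (unit_at {w}) (?d, id, shift {} ?d) \<in> I"
    using prod_list_xop_eqv[of xs] assms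
    by (intro negl_app unit_at_supp) (simp_all add: eqv_def permutes_id)
  moreover have "app (prod_list (map Aop xs)) (unit_at {w}) (?d, id, shift {} ?d) = 0"
    using flat_prod_list[of xs "{w}"] assms(3) by (simp add: flat_def)
  moreover have "app (prod_list (map (xop V) xs)) (unit_at {w}) (?d, id, shift {} ?d) = omit_sum tz xs"
    using assms by (intro omit_top) (auto simp: permutes_id)
  ultimately show ?thesis by (simp add: minus_opr.rep_eq)
qed

end

text \<open>Sets containing the least element \<open>x\<close> correspond to sets with one element
  less in the tail, and \<open>x\<close> heads their sorted lists.\<close>

lemma elsym_sorted:
  fixes F :: "'a::linorder \<Rightarrow> 'b::ring_1"
  shows "sorted xs \<Longrightarrow> distinct xs \<Longrightarrow> elsym (map F xs) k =
    (\<Sum>S | S \<subseteq> set xs \<and> card S = k. prod_list (map F (sorted_list_of_set S)))"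
proof (induction xs arbitrary: k)
  case Nil
  have "{S :: 'a set. S \<subseteq> set [] \<and> card S = k} = (if k = 0 then {{}} else {})" by auto
  then show ?case by (simp only:) simp
next
  case (Cons x xs)
  let ?p = "\<lambda>S. prod_list (map F (sorted_list_of_set S))"
  let ?P = "\<lambda>A k. {S. S \<subseteq> A \<and> card S = k}"
  have fin: "finite (?P A k)" if "finite A" for A :: "'a set" and k
    using that by (rule rev_finite_subset[OF finite_Pow_iff[THEN iffD2]]) auto
  have x: "x \<notin> set xs" "\<forall>y\<in>set xs. x < y" using Cons.prems by (auto simp: order.strict_iff_order)
  show ?case
  proof (cases k)
    case 0
    have "?P A 0 = {{}}" if "finite A" for A :: "'a set" using that finite_subset by fastforce
    then show ?thesis using 0 by simp
  next
    case (Suc j)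
    have "?P (set (x # xs)) k = ?P (set xs) k \<union> insert x ` ?P (set xs) j"
    proof (intro equalityI subsetI)
      fix S assume S: "S \<in> ?P (set (x # xs)) k"
      show "S \<in> ?P (set xs) k \<union> insert x ` ?P (set xs) j"
      proof (cases "x \<in> S")
        case True
        have "finite S" using S finite_subset[of S "set (x # xs)"] by auto
        then have "S = insert x (S - {x})" "S - {x} \<in> ?P (set xs) j"
          using True S Suc by auto
        then show ?thesis by blast
      qed (use S in auto)
    next
      fix S assume "S \<in> ?P (set xs) k \<union> insert x ` ?P (set xs) j"
      moreover have "card (insert x S') = k" if "S' \<in> ?P (set xs) j" for S'
      proof -
        have "finite S'" "x \<notin> S'" using that x(1) finite_subset[of S' "set xs"] by auto
        then show ?thesis using that Suc by simp
      qed
      ultimately show "S \<in> ?P (set (x # xs)) k" by auto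
    qed
    then have "sum ?p (?P (set (x # xs)) k) = sum ?p (?P (set xs) k) + sum ?p (insert x ` ?P (set xs) j)"
      using x(1) fin by (simp only:) (intro sum.union_disjoint, auto)
    also have "sum ?p (insert x ` ?P (set xs) j) = (\<Sum>S\<in>?P (set xs) j. F x * ?p S)"
    proof (subst sum.reindex)
      show "inj_on (insert x) (?P (set xs) j)" using x(1) by (auto simp: inj_on_def)
      show "sum (?p \<circ> insert x) (?P (set xs) j) = (\<Sum>S\<in>?P (set xs) j. F x * ?p S)"
      proof (rule sum.cong[OF refl])
        fix S assume S: "S \<in> ?P (set xs) j"
        then have "finite S" using finite_subset[of S "set xs"] by auto
        moreover have "x \<notin> S" "\<forall>y\<in>S. x < y" using S x by auto
        ultimately have "sorted_list_of_set (insert x S) = x # sorted_list_of_set S"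
          by (simp add: insort_is_Cons less_imp_le)
        then show "(?p \<circ> insert x) S = F x * ?p S" by simp
      qed
    qed
    finally show ?thesis using Cons by (simp add: Suc sum_distrib_left)
  qed
qed

lemma omit_sum_upt:
  "omit_sum F [a..<b] = (\<Sum>i\<in>{a..<b}. (- 1) ^ (b - 1 - i) * prod_list (map F (filter (\<lambda>j. j \<noteq> i) [a..<b])))"
proof (induction "b - a" arbitrary: a)
  case (Suc m)
  then have ab: "a < b" by simp
  have upt: "[a..<b] = a # [Suc a..<b]" using ab by (rule upt_conv_Cons)
  have "omit_sum F [Suc a..<b] =
      (\<Sum>i\<in>{Suc a..<b}. (- 1) ^ (b - 1 - i) * prod_list (map F (filter (\<lambda>j. j \<noteq> i) [Suc a..<b])))"
    using Suc by simp
  then have "F a * omit_sum F [Suc a..<b] =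
      (\<Sum>i\<in>{Suc a..<b}. (- 1) ^ (b - 1 - i) * prod_list (map F (filter (\<lambda>j. j \<noteq> i) [a..<b])))"
    unfolding upt by (auto simp: sum_distrib_left minus_one_power_iff intro!: sum.cong)
  moreover have "filter (\<lambda>j. j \<noteq> a) [a..<b] = [Suc a..<b]"
    unfolding upt by (simp add: filter_id_conv)
  moreover have "{a..<b} = insert a {Suc a..<b}" using ab by auto
  ultimately show ?case by (subst upt) simp
qed simp

section \<open>The quadratic algebra\<close>

definition coset :: "nat \<Rightarrow> (nat set fmon \<Rightarrow>\<^sub>0 'k::field) \<Rightarrow> (nat set fmon \<Rightarrow>\<^sub>0 'k) set" where
  "coset n p = quad_ideal n +>\<^bsub>free_algebra (transps n)\<^esub> p"

abbreviation quad_carrier :: "nat \<Rightarrow> (nat set fmon \<Rightarrow>\<^sub>0 'k::field) set" where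
  "quad_carrier n \<equiv> carrier (free_algebra (transps n))"

lemma coset_ring_hom: "coset n \<in> ring_hom (free_algebra (transps n)) (Lambda_quad K n)"
  using ideal.rcos_ring_hom[OF quad_ideal_ideal]
  unfolding ring_hom_def coset_def Lambda_quad_simps .

lemma coset_hom:
  shows coset_closed: "p \<in> quad_carrier n \<Longrightarrow> coset n p \<in> carrier (Lambda_quad K n)"
    and coset_mult: "p \<in> quad_carrier n \<Longrightarrow> q \<in> quad_carrier n \<Longrightarrow>
      coset n (p * q) = coset n p \<otimes>\<^bsub>Lambda_quad K n\<^esub> coset n q"
    and coset_add: "p \<in> quad_carrier n \<Longrightarrow> q \<in> quad_carrier n \<Longrightarrow>
      coset n (p + q) = coset n p \<oplus>\<^bsub>Lambda_quad K n\<^esub> coset n q"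
    and coset_one: "coset n 1 = \<one>\<^bsub>Lambda_quad K n\<^esub>"
    and coset_zero: "coset n 0 = \<zero>\<^bsub>Lambda_quad K n\<^esub>"
  using ring_hom_closed[OF coset_ring_hom[of n K], of p] ring_hom_mult[OF coset_ring_hom[of n K], of p q]
    ring_hom_add[OF coset_ring_hom[of n K], of p q] ring_hom_one[OF coset_ring_hom[of n K]]
    ring_hom_zero[OF coset_ring_hom[of n K] free_algebra_ring Lambda_quad_ring]
  by (simp_all del: free_algebra_simps(1))

lemma coset_eq_zero: "p \<in> quad_ideal n \<Longrightarrow> coset n p = \<zero>\<^bsub>Lambda_quad K n\<^esub>"
proof -
  interpret ideal "quad_ideal n" "free_algebra (transps n) :: ('a, nat set fmon \<Rightarrow>\<^sub>0 'a) module"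
    by (rule quad_ideal_ideal)
  assume "p \<in> quad_ideal n"
  then show ?thesis unfolding coset_def Lambda_quad_simps FactRing_def using a_rcos_const by simp
qed

lemma coset_sum:
  assumes "finite S" "\<And>s. s \<in> S \<Longrightarrow> F s \<in> quad_carrier n"
  shows "sum F S \<in> quad_carrier n \<and>
    coset n (sum F S) = (\<Oplus>\<^bsub>Lambda_quad K n\<^esub> s\<in>S. coset n (F s))"
  using assms
proof (induction S)
  case empty
  interpret Q: ring "Lambda_quad K n" by (rule Lambda_quad_ring)
  show ?case using coset_zero[of n K] by simp
next
  case (insert s S)
  interpret Q: ring "Lambda_quad K n" by (rule Lambda_quad_ring)
  have "(\<Oplus>\<^bsub>Lambda_quad K n\<^esub> t\<in>insert s S. coset n (F t)) =
      coset n (F s) \<oplus>\<^bsub>Lambda_quad K n\<^esub> (\<Oplus>\<^bsub>Lambda_quad K n\<^esub> t\<in>S. coset n (F t))"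
    using insert by (intro Q.finsum_insert) (auto simp del: free_algebra_simps(1) intro!: coset_closed)
  then show ?case
    using insert coset_add[of "F s" n "sum F S" K] free_algebra_add_closed[of "F s" "transps n" "sum F S"]
    by (simp del: free_algebra_simps(1))
qed

lemma one_closed: "1 \<in> quad_carrier n"
  by (auto simp: zero_fmon_def simp flip: single_one)

lemma coset_prod_list:
  assumes "\<And>s. s \<in> set xs \<Longrightarrow> F s \<in> quad_carrier n"
  shows "prod_list (map F xs) \<in> quad_carrier n \<and>
    coset n (prod_list (map F xs)) = list_prod (Lambda_quad K n) (map (\<lambda>s. coset n (F s)) xs)"
  using assms
proof (induction xs)
  case Nil
  then show ?case using one_closed coset_one[of n K] by (simp add: list_prod_def del: free_algebra_simps(1))
next
  case (Cons x xs)
  then show ?case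
    using coset_mult[of "F x" n "prod_list (map F xs)" K]
      free_algebra_mult_closed[of "F x" "transps n" "prod_list (map F xs)"]
    by (simp add: list_prod_def del: free_algebra_simps(1))
qed

text \<open>The index \<open>Suc n\<close> lies outside \<open>{1..n}\<close> and is free for
  \<tau>.\<close>

lemma quad_ideal_anticomm:
  "anticomm_quad {1..n} (Suc n) (quad_carrier n)
    (quad_ideal n :: (nat set fmon \<Rightarrow>\<^sub>0 'k::field_char_0) set) (\<lambda>i j. free_gen {i, j})"
proof -
  let ?F = "free_algebra (transps n) :: ('k, nat set fmon \<Rightarrow>\<^sub>0 'k) module"
  let ?I = "quad_ideal n :: (nat set fmon \<Rightarrow>\<^sub>0 'k) set"
  interpret ideal ?I ?F by (rule quad_ideal_ideal)
  have rels: "quad_rels n \<subseteq> ?I"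
    unfolding quad_ideal_def by (rule ring.genideal_self[OF free_algebra_ring quad_rels_closed])
  have scalar: "Poly_Mapping.single 0 c \<in> carrier ?F" for c by (auto simp: zero_fmon_def)
  show ?thesis
  proof
    show "of_int m \<in> carrier ?F" for m using scalar[of "of_int m"] by (simp only: single_of_int)
    show "p + q \<in> carrier ?F" "p * q \<in> carrier ?F" if "p \<in> carrier ?F" "q \<in> carrier ?F" for p q
      using that by (rule free_algebra_add_closed, rule free_algebra_mult_closed)
    show "0 \<in> ?I" using additive_subgroup.zero_closed[OF ideal.axioms(1)[OF quad_ideal_ideal]] by fastforce
    show "p + q \<in> ?I" if "p \<in> ?I" "q \<in> ?I" for p q using additive_subgroup.a_closed[OF ideal.axioms(1)[OF quad_ideal_ideal] that] by simp
    show "p * q \<in> ?I" if "p \<in> carrier ?F" "q \<in> ?I" for p q using I_l_closed[OF that(2,1)] by simp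
    show "p * q \<in> ?I" if "p \<in> ?I" "q \<in> carrier ?F" for p q using I_r_closed[OF that] by simp
    show "p \<in> ?I" if "m \<noteq> 0" "of_int m * p \<in> ?I" for m p
    proof -
      \<comment> \<open>Characteristic zero makes the nonzero integer \<open>m\<close> invertible
        among the scalars.\<close>
      have "Poly_Mapping.single 0 (1 / of_int m) * (of_int m * p) \<in> ?I"
        using I_l_closed[OF that(2) scalar] by simp
      moreover have "Poly_Mapping.single (0 :: nat set fmon) (1 / of_int m :: 'k) * of_int m = 1"
        using that(1) by (simp add: mult_single flip: single_of_int)
      ultimately show ?thesis by (simp flip: mult.assoc)
    qed
    show "free_gen {i, j} \<in> carrier ?F" if "i \<in> {1..n}" "j \<in> {1..n}" "i \<noteq> j" for i j
      using that by (intro free_gen_closed transps_memI)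
    show "free_gen {i, j} * free_gen {i, j} \<in> ?I" if "i \<in> {1..n}" "j \<in> {1..n}" "i \<noteq> j" for i j
      by (rule subsetD[OF rels]) (use that in \<open>unfold quad_rels_def, blast\<close>)
    show "free_gen {i, j} * free_gen {k, l} + free_gen {k, l} * free_gen {i, j} \<in> ?I"
      if "i \<in> {1..n}" "j \<in> {1..n}" "k \<in> {1..n}" "l \<in> {1..n}" "i \<noteq> j" "k \<noteq> l" "{i, j} \<inter> {k, l} = {}"
      for i j k l
      by (rule subsetD[OF rels]) (use that in \<open>unfold quad_rels_def, blast\<close>)
    show "free_gen {i, j} * free_gen {j, k} + free_gen {j, k} * free_gen {k, i} +
        free_gen {k, i} * free_gen {i, j} \<in> ?I"
      if "i \<in> {1..n}" "j \<in> {1..n}" "k \<in> {1..n}" "i \<noteq> j" "j \<noteq> k" "i \<noteq> k" for i j k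
      by (rule subsetD[OF rels]) (use that in \<open>unfold quad_rels_def, blast\<close>)
  qed (auto simp: insert_commute)
qed

theorem theorem5p1:
  fixes n :: nat and K :: "'k::field_char_0 itself"
  assumes "n \<ge> 2"
  shows "(\<forall>k \<in> {1..n}.
            esym (Lambda_quad K n) n k (\<lambda>i. theta K n i [^]\<^bsub>Lambda_quad K n\<^esub> (2::nat))
              = \<zero>\<^bsub>Lambda_quad K n\<^esub>)
       \<and> list_prod (Lambda_quad K n) (map (theta K n) [1..<n+1]) = \<zero>\<^bsub>Lambda_quad K n\<^esub>
       \<and> (\<Oplus>\<^bsub>Lambda_quad K n\<^esub> i \<in> {1..n}.
            (- 1) ^ (i + 1) \<odot>\<^bsub>Lambda_quad K n\<^esub>
              list_prod (Lambda_quad K n)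
                (map (theta K n) (filter (\<lambda>j. j \<noteq> i) [1..<n+1])))
            = \<zero>\<^bsub>Lambda_quad K n\<^esub>"
proof -
  let ?Q = "Lambda_quad K n"
  let ?C = "quad_carrier n :: (nat set fmon \<Rightarrow>\<^sub>0 'k) set"
  let ?I = "quad_ideal n :: (nat set fmon \<Rightarrow>\<^sub>0 'k) set"
  interpret A: anticomm_quad "{1..n}" "Suc n" ?C ?I "\<lambda>i j. free_gen {i, j}"
    by (rule quad_ideal_anticomm)
  interpret Q: ring ?Q by (rule Lambda_quad_ring)
  define xs where "xs = [1..<n + 1]"
  have xs: "distinct xs" "set xs = {1..n}" "length xs = n" "sorted xs"
    unfolding xs_def by (simp_all only: sorted_upt distinct_upt set_upt length_upt) auto
  \<comment> \<open>\<open>A.tz i\<close> lifts \<open>theta K n i\<close> to the free algebra,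
    where vanishing in the quotient becomes membership in the ideal.\<close>
  define t :: "nat \<Rightarrow> nat set fmon \<Rightarrow>\<^sub>0 'k" where "t = A.tz"
  have t: "t i \<in> ?C \<and> coset n (t i) = theta K n i" if "i \<in> {1..n}" for i
    unfolding t_def A.tz_def theta_def transp_gen_def coset_def[symmetric]
    using that by (intro coset_sum) (auto intro!: free_gen_closed transps_memI simp del: free_algebra_simps(1))
  have t_prod: "prod_list (map t ys) \<in> ?C \<and>
      coset n (prod_list (map t ys)) = list_prod ?Q (map (theta K n) ys)" if "set ys \<subseteq> {1..n}" for ys
  proof -
    have "map (\<lambda>i. coset n (t i)) ys = map (theta K n) ys" using t that by auto
    moreover have "t i \<in> ?C" if "i \<in> set ys" for i using t that \<open>set ys \<subseteq> {1..n}\<close> by blast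
    ultimately show ?thesis using coset_prod_list[of ys t n K] by (simp only:)
  qed
  have "esym ?Q n k (\<lambda>i. theta K n i [^]\<^bsub>?Q\<^esub> (2::nat)) = \<zero>\<^bsub>?Q\<^esub>" if k: "k \<in> {1..n}" for k
  proof -
    let ?P = "{S. S \<subseteq> {1..n} \<and> card S = k}"
    let ?s = "\<lambda>i. t i * t i"
    have sq: "?s i \<in> ?C \<and> coset n (?s i) = theta K n i [^]\<^bsub>?Q\<^esub> (2::nat)" if "i \<in> {1..n}" for i
    proof -
      have "theta K n i \<in> carrier ?Q"
        using coset_closed[OF conjunct1[OF t[OF that]], of K] unfolding conjunct2[OF t[OF that]] .
      then have "theta K n i [^]\<^bsub>?Q\<^esub> (2::nat) = theta K n i \<otimes>\<^bsub>?Q\<^esub> theta K n i"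
        by (simp add: numeral_2_eq_2)
      then show ?thesis
        using t[OF that] coset_mult[of "t i" n "t i" K] free_algebra_mult_closed[of "t i" "transps n" "t i"]
        by (simp only:)
    qed
    have P: "prod_list (map ?s (sorted_list_of_set S)) \<in> ?C \<and>
        coset n (prod_list (map ?s (sorted_list_of_set S))) =
        list_prod ?Q (map (\<lambda>i. theta K n i [^]\<^bsub>?Q\<^esub> (2::nat)) (sorted_list_of_set S))"
      if "S \<in> ?P" for S
    proof -
      have S: "set (sorted_list_of_set S) \<subseteq> {1..n}" using that finite_subset[of S "{1..n}"] by auto
      have "map (\<lambda>i. coset n (?s i)) (sorted_list_of_set S) =
          map (\<lambda>i. theta K n i [^]\<^bsub>?Q\<^esub> (2::nat)) (sorted_list_of_set S)"
        using sq S by (intro map_cong refl) blast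
      moreover have "?s i \<in> ?C" if "i \<in> set (sorted_list_of_set S)" for i using sq S that by blast
      ultimately show ?thesis using coset_prod_list[of "sorted_list_of_set S" ?s n K] by (simp only:)
    qed
    have "elsym (map ?s xs) k \<in> ?I"
      unfolding t_def by (rule A.tz_elsym[OF xs(1,2)]) (use xs(3) k assms in auto)
    moreover have "elsym (map ?s xs) k = (\<Sum>S\<in>?P. prod_list (map ?s (sorted_list_of_set S)))"
      using elsym_sorted[OF xs(4,1), of ?s k] unfolding xs(2) .
    ultimately have e1: "coset n (\<Sum>S\<in>?P. prod_list (map ?s (sorted_list_of_set S))) = \<zero>\<^bsub>?Q\<^esub>"
      by (intro coset_eq_zero) (simp only:)
    have finP: "finite ?P" by (rule finite_subset[of _ "Pow {1..n}"]) auto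
    have e2: "coset n (\<Sum>S\<in>?P. prod_list (map ?s (sorted_list_of_set S))) =
        (\<Oplus>\<^bsub>?Q\<^esub> S\<in>?P. coset n (prod_list (map ?s (sorted_list_of_set S))))"
      by (rule conjunct2[OF coset_sum[OF finP conjunct1[OF P]]])
    have e3: "\<dots> = esym ?Q n k (\<lambda>i. theta K n i [^]\<^bsub>?Q\<^esub> (2::nat))"
      unfolding esym_def
    proof (rule Q.finsum_cong'[OF refl])
      show "(\<lambda>S. list_prod ?Q (map (\<lambda>i. theta K n i [^]\<^bsub>?Q\<^esub> (2::nat)) (sorted_list_of_set S)))
          \<in> ?P \<rightarrow> carrier ?Q"
      proof (rule Pi_I)
        fix S assume "S \<in> ?P"
        note P = P[OF this]
        show "list_prod ?Q (map (\<lambda>i. theta K n i [^]\<^bsub>?Q\<^esub> (2::nat)) (sorted_list_of_set S)) \<in> carrier ?Q"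
          using coset_closed[OF conjunct1[OF P], of K] unfolding conjunct2[OF P] .
      qed
    qed (rule conjunct2[OF P])
    show ?thesis by (rule trans[OF e3[symmetric] trans[OF e2[symmetric] e1]])
  qed
  moreover have "list_prod ?Q (map (theta K n) xs) = \<zero>\<^bsub>?Q\<^esub>"
  proof -
    have "prod_list (map t xs) \<in> ?I" 
      unfolding t_def by (rule A.tz_prod_list[OF xs(1,2)]) (use xs(3) assms in auto)
    then have "coset n (prod_list (map t xs)) = \<zero>\<^bsub>?Q\<^esub>" by (rule coset_eq_zero)
    then show ?thesis using t_prod[of xs] xs(2) by (simp only: order_refl)
  qed
  moreover have "(\<Oplus>\<^bsub>?Q\<^esub> i \<in> {1..n}. (- 1) ^ (i + 1) \<odot>\<^bsub>?Q\<^esub>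
      list_prod ?Q (map (theta K n) (filter (\<lambda>j. j \<noteq> i) xs))) = \<zero>\<^bsub>?Q\<^esub>"
  proof -
    have sign: "(- 1) ^ m \<in> ?C" for m
      using A.C_of_int[of "(- 1) ^ m"] unfolding of_int_power of_int_minus of_int_1 .
    let ?p = "\<lambda>i. prod_list (map t (filter (\<lambda>j. j \<noteq> i) xs))"
    have p: "(- 1) ^ (i + 1) * ?p i \<in> ?C \<and> coset n ((- 1) ^ (i + 1) * ?p i) =
        (- 1) ^ (i + 1) \<odot>\<^bsub>?Q\<^esub> list_prod ?Q (map (theta K n) (filter (\<lambda>j. j \<noteq> i) xs))" for i
    proof -
      have sub: "set (filter (\<lambda>j. j \<noteq> i) xs) \<subseteq> {1..n}" unfolding xs(2)[symmetric] by (rule filter_is_subset)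
      have pi: "?p i \<in> ?C" "coset n (?p i) = list_prod ?Q (map (theta K n) (filter (\<lambda>j. j \<noteq> i) xs))"
        by (rule conjunct1[OF t_prod[OF sub]], rule conjunct2[OF t_prod[OF sub]])
      have s: "Poly_Mapping.single 0 ((- 1) ^ (i + 1)) = ((- 1) ^ (i + 1) :: nat set fmon \<Rightarrow>\<^sub>0 'k)"
        using single_of_int[of "(- 1) ^ (i + 1)"] by simp
      have "(- 1) ^ (i + 1) * ?p i \<in> ?C" by (rule A.C_mult[OF sign pi(1)])
      moreover have "(- 1) ^ (i + 1) \<odot>\<^bsub>?Q\<^esub> coset n (?p i) = coset n ((- 1) ^ (i + 1) * ?p i)"
        unfolding coset_def Lambda_quad_smult[OF pi(1)] free_algebra_simps s ..
      ultimately show ?thesis using pi(2) by (simp only:)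
    qed
    have "omit_sum t xs \<in> ?I"
      unfolding t_def by (rule A.tz_omit_sum[OF xs(1,2)]) (use xs(3) assms in auto)
    \<comment> \<open>The signs of \<open>omit_sum\<close> are \<open>(- 1) ^ (n - i)\<close>; the
      global factor turns them into \<open>(- 1) ^ (i + 1)\<close>.\<close>
    then have "(- 1) ^ (n + 1) * omit_sum t xs \<in> ?I" by (rule A.I_left[OF sign])
    also have "omit_sum t xs = (\<Sum>i\<in>{1..n}. (- 1) ^ (n - i) * ?p i)"
    proof -
      have "{1..<n + 1} = {1..n}" by auto
      then show ?thesis unfolding xs_def omit_sum_upt by (simp only: add_diff_cancel_right')
    qed
    also have "(- 1) ^ (n + 1) * \<dots> = (\<Sum>i\<in>{1..n}. (- 1) ^ (i + 1) * ?p i)"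
      unfolding sum_distrib_left
    proof (rule sum.cong[OF refl])
      fix i assume "i \<in> {1..n}"
      then obtain m where "n = i + m" by (auto simp: le_iff_add)
      then have "even (n + 1 + (n - i)) = even (i + 1)" by auto
      then have "(- 1) ^ (n + 1) * (- 1) ^ (n - i) = ((- 1) ^ (i + 1) :: nat set fmon \<Rightarrow>\<^sub>0 'k)"
        unfolding power_add[symmetric] by (simp only: minus_one_power_iff)
      then show "(- 1) ^ (n + 1) * ((- 1) ^ (n - i) * ?p i) = (- 1) ^ (i + 1) * ?p i"
        by (simp only: mult.assoc[symmetric])
    qed
    finally have e1: "coset n (\<Sum>i\<in>{1..n}. (- 1) ^ (i + 1) * ?p i) = \<zero>\<^bsub>?Q\<^esub>" by (rule coset_eq_zero)
    have e2: "coset n (\<Sum>i\<in>{1..n}. (- 1) ^ (i + 1) * ?p i) =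
        (\<Oplus>\<^bsub>?Q\<^esub> i\<in>{1..n}. coset n ((- 1) ^ (i + 1) * ?p i))"
      by (rule conjunct2[OF coset_sum[OF finite_atLeastAtMost conjunct1[OF p]]])
    have e3: "\<dots> = (\<Oplus>\<^bsub>?Q\<^esub> i \<in> {1..n}. (- 1) ^ (i + 1) \<odot>\<^bsub>?Q\<^esub>
        list_prod ?Q (map (theta K n) (filter (\<lambda>j. j \<noteq> i) xs)))"
    proof (rule Q.finsum_cong'[OF refl])
      show "(\<lambda>i. (- 1) ^ (i + 1) \<odot>\<^bsub>?Q\<^esub> list_prod ?Q (map (theta K n) (filter (\<lambda>j. j \<noteq> i) xs)))
          \<in> {1..n} \<rightarrow> carrier ?Q"
      proof (rule Pi_I)
        fix i
        show "(- 1) ^ (i + 1) \<odot>\<^bsub>?Q\<^esub> list_prod ?Q (map (theta K n) (filter (\<lambda>j. j \<noteq> i) xs)) \<in> carrier ?Q"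
          using coset_closed[OF conjunct1[OF p[of i]], of K] unfolding conjunct2[OF p[of i]] .
      qed
    qed (rule conjunct2[OF p])
    show ?thesis by (rule trans[OF e3[symmetric] trans[OF e2[symmetric] e1]])
  qed
  ultimately show ?thesis unfolding xs_def by blast
qed

end
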